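(* Let $\mathcal{A}$ be an anchored bundle over $M$ with projection $\tau$, and let $\mathfrak{D}=\{D_i\}_{i\in I}$ be a finite set of differential operators on $\mathcal{A}$, with symbols $\{\hat{D}_i\}_{i\in I}$. Let $\xi=\{\xi^i\}_{i\in I}$ be a family of sections of the dual bundle $\mathcal{A}^*$ such that the dual operators satisfy $$D_i^*(\xi^j)=g_{ik}^j\xi^k$$ with $g_{ik}^j\in C^\infty(M)$. Let $\{h_{ij}^k\}_{i,j,k\in I}$ be a family of functions in $C^\infty(M)$, skew-symmetric in the lower indices ($h_{ij}^k=-h_{ji}^k$). Writing $X^i:=\langle X,\xi^i\rangle$ for $X\in\Gamma(\mathcal{A})$, define $$\mathfrak{a}_{\mathcal{A}}^{(\mathfrak{D},\xi)}:\wedge^2\Gamma(\mathcal{A})\to\Gamma(TM),\quad\mathfrak{a}_{\mathcal{A}}^{(\mathfrak{D},\xi)}(X\wedge Y):=X^iY^jh_{ij}^s\hat{D}_s,$$ $$\nabla^{(\mathfrak{D},\xi)}:\wedge^2\Gamma(\mathcal{A})\otimes\Gamma(\mathcal{A})\to\Gamma(\mathcal{A}),\quad\nabla^{(\mathfrak{D},\xi)}_{X\wedge Y}(Z):=X^iY^jh_{ij}^sD_s(Z),$$ $$[X,Y,Z]^{\nabla^{(\mathfrak{D},\xi)}}:=\nabla^{(\mathfrak{D},\xi)}_{X\wedge Y}(Z)+\nabla^{(\mathfrak{D},\xi)}_{Z\wedge X}(Y)+\nabla^{(\mathfrak{D},\xi)}_{Y\wedge Z}(X).$$ If, for all values of the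 free indices in $I$, $$h_{k\ell}^rh_{ij}^s+h_{i\ell}^rh_{jk}^s+h_{j\ell}^rh_{ki}^s=0,$$ $$h_{ij}^sh_{k\ell}^r=h_{ij}^rh_{k\ell}^s,$$ $$\hat{D}_r(h_{ij}^t)=g_{ri}^sh_{js}^t+g_{rj}^sh_{si}^t,$$ then $(\mathcal{A},\tau,M,\mathfrak{a}_{\mathcal{A}}^{(\mathfrak{D},\xi)},[\bullet,\bullet,\bullet]^{\nabla^{(\mathfrak{D},\xi)}})$ is a 3-Lie algebroid.
   Context: Repeated indices (one upper, one lower) are summed over $I$; in the first two displayed conditions all indices are free. An anchored bundle is a smooth vector bundle $\tau:\mathcal{A}\to M$ with a vector bundle morphism $\mathcal{A}\to TM$. A differential operator on $\mathcal{A}$ is an $\mathbb{R}$-linear map $D:\Gamma(\mathcal{A})\to\Gamma(\mathcal{A})$ together with a vector field $\hat{D}\in\Gamma(TM)$ (its symbol) such that $D(fY)=fD(Y)+\hat{D}(f)Y$ for all $Y\in\Gamma(\mathcal{A})$, $f\in C^\infty(M)$. Its dual operator $D^*:\Gamma(\mathcal{A}^* )\to\Gamma(\mathcal{A}^* )$ is defined by $\langle X,D^*(\zeta)\rangle:=\hat{D}(\langle X,\zeta\rangle)-\langle D(X),\zeta\rangle$. A 3-Lie algebroid is a vector bundle $\tau:\mathcal{A}\to M$ with a 3-anchor, i.e. a bundle map $\mathfrak{a}:\wedge^2\mathcal{A}\to TM$ (viewed as a skew-symmetric $C^\infty(M)$-bilinear map on sections), and a skew-symmetric $\mathbb{R}$-trilinear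 bracket $[\bullet,\bullet,\bullet]$ on $\Gamma(\mathcal{A})$ satisfying, for all sections and all $f\in C^\infty(M)$: (i) the fundamental identity $[X_1,X_2,[Y_1,Y_2,Y_3]]=[[X_1,X_2,Y_1],Y_2,Y_3]+[Y_1,[X_1,X_2,Y_2],Y_3]+[Y_1,Y_2,[X_1,X_2,Y_3]]$; (ii) the Leibniz rule $[X_1,X_2,fY]=f[X_1,X_2,Y]+\mathfrak{a}(X_1\wedge X_2)(f)Y$; (iii) $\mathfrak{a}([X_1,X_2,Y_1]\wedge Y_2+Y_1\wedge[X_1,X_2,Y_2])=[\mathfrak{a}(X_1\wedge X_2),\mathfrak{a}(Y_1\wedge Y_2)]$, with the Lie bracket of vector fields on the right. *)

theory Defs
  imports "HOL-Analysis.Analysis"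
begin

section \<open>Smooth functions on open subsets of Euclidean space\<close>

text \<open>As in \<^const>\<open>Euclidean_space\<close>, the space \<open>R^n\<close> consists of the sequences that vanish
  from index \<open>n\<close> on, so that dimensions and ranks are natural numbers and may be \<open>0\<close>. The product
  topology on \<^typ>\<open>nat \<Rightarrow> real\<close> induces the usual topology on this subset.\<close>

definition partial_deriv :: "nat \<Rightarrow> ((nat \<Rightarrow> real) \<Rightarrow> real) \<Rightarrow> (nat \<Rightarrow> real) \<Rightarrow> real" where
  "partial_deriv i f x = deriv (\<lambda>t. f (x(i := t))) (x i)"

fun Ck_on :: "nat \<Rightarrow> nat \<Rightarrow> (nat \<Rightarrow> real) set \<Rightarrow> ((nat \<Rightarrow> real) \<Rightarrow> real) \<Rightarrow> bool" where
  "Ck_on 0 n V f \<longleftrightarrow> continuous_on V f"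
| "Ck_on (Suc k) n V f \<longleftrightarrow> continuous_on V f \<and>
     (\<forall>i<n. (\<forall>x\<in>V. (\<lambda>t. f (x(i := t))) differentiable (at (x i))) \<and>
            Ck_on k n V (partial_deriv i f))"

text \<open>To be used only for \<open>V\<close> open in \<open>R^n\<close>.\<close>

definition Cinf_on :: "nat \<Rightarrow> (nat \<Rightarrow> real) set \<Rightarrow> ((nat \<Rightarrow> real) \<Rightarrow> real) \<Rightarrow> bool" where
  "Cinf_on n V f \<longleftrightarrow> (\<forall>k. Ck_on k n V f)"

section \<open>Smooth manifolds\<close>

text \<open>The underlying Hausdorff, second countable space is a whole type \<open>'m\<close>; the smooth
  structure is the one determined by an atlas of pairs of a domain and a coordinate map.\<close>

record 'm manifold =
  mdim :: nat
  charts :: "('m set \<times> ('m \<Rightarrow> nat \<Rightarrow> real)) set"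

definition smooth_manifold ::
    "'m::{t2_space,second_countable_topology} manifold \<Rightarrow> bool" where
  "smooth_manifold M \<longleftrightarrow>
     (\<Union>(U, \<phi>)\<in>charts M. U) = UNIV \<and>
     (\<forall>(U, \<phi>)\<in>charts M. open U \<and> openin (Euclidean_space (mdim M)) (\<phi> ` U) \<and>
        homeomorphism U (\<phi> ` U) \<phi> (inv_into U \<phi>)) \<and>
     (\<forall>(U, \<phi>)\<in>charts M. \<forall>(V, \<psi>)\<in>charts M. \<forall>b<mdim M.
        Cinf_on (mdim M) (\<phi> ` (U \<inter> V)) (\<lambda>x. \<psi> (inv_into U \<phi> x) b))"

text \<open>To be used only for open \<open>W\<close>.\<close>

definition smooth_fun_on ::
    "'m::{t2_space,second_countable_topology} manifold \<Rightarrow> 'm set \<Rightarrow> ('m \<Rightarrow> real) \<Rightarrow> bool" where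
  "smooth_fun_on M W f \<longleftrightarrow>
     (\<forall>(U, \<phi>)\<in>charts M. Cinf_on (mdim M) (\<phi> ` (U \<inter> W)) (\<lambda>x. f (inv_into U \<phi> x)))"

definition smooth_funs ::
    "'m::{t2_space,second_countable_topology} manifold \<Rightarrow> ('m \<Rightarrow> real) set" where
  "smooth_funs M = {f. smooth_fun_on M UNIV f}"

section \<open>Tangent vectors and vector fields\<close>

text \<open>Tangent vectors at \<open>p\<close> are the derivations of \<open>C^\<infinity>(M)\<close> at \<open>p\<close>. They are extended by \<open>0\<close> to
  functions that are not smooth, so that equality of tangent vectors is equality in HOL.\<close>

definition tangent_space ::
    "'m::{t2_space,second_countable_topology} manifold \<Rightarrow> 'm \<Rightarrow> (('m \<Rightarrow> real) \<Rightarrow> real) set" where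
  "tangent_space M p =
     {v. (\<forall>f\<in>smooth_funs M. \<forall>g\<in>smooth_funs M. \<forall>a b.
            v (\<lambda>q. a * f q + b * g q) = a * v f + b * v g) \<and>
         (\<forall>f\<in>smooth_funs M. \<forall>g\<in>smooth_funs M.
            v (\<lambda>q. f q * g q) = f p * v g + g p * v f) \<and>
         (\<forall>f. f \<notin> smooth_funs M \<longrightarrow> v f = 0)}"

type_synonym 'm vfield = "'m \<Rightarrow> ('m \<Rightarrow> real) \<Rightarrow> real"

definition vf_app :: "'m vfield \<Rightarrow> ('m \<Rightarrow> real) \<Rightarrow> 'm \<Rightarrow> real" where
  "vf_app V f = (\<lambda>p. V p f)"

definition vector_fields ::
    "'m::{t2_space,second_countable_topology} manifold \<Rightarrow> 'm vfield set" where
  "vector_fields M =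
     {V. (\<forall>p. V p \<in> tangent_space M p) \<and> (\<forall>f\<in>smooth_funs M. vf_app V f \<in> smooth_funs M)}"

definition lie_bracket :: "'m vfield \<Rightarrow> 'm vfield \<Rightarrow> 'm vfield" where
  "lie_bracket V W = (\<lambda>p f. V p (vf_app W f) - W p (vf_app V f))"

section \<open>Vector bundles\<close>

text \<open>The fibre over \<open>p\<close> is a linear subspace of a real vector space \<open>'v\<close> that does not depend on
  \<open>p\<close>; this is no restriction, since \<open>'v\<close> may contain the direct sum of all fibres. The total
  space is \<open>SIGMA p:UNIV. fibre A p\<close> with projection \<^const>\<open>fst\<close>; its topology and smooth
  structure are those determined by the bundle atlas \<open>trivs A\<close>. A local trivialization over \<open>U\<close>
  is a pair \<open>(U, \<Phi>)\<close>, where \<open>\<Phi> p\<close> is a linear isomorphism from the fibre over \<open>p\<close> onto \<open>R^r\<close>.\<close>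

record ('m, 'v) vbundle =
  rk :: nat
  fibre :: "'m \<Rightarrow> 'v set"
  trivs :: "('m set \<times> ('m \<Rightarrow> 'v \<Rightarrow> nat \<Rightarrow> real)) set"

definition frame ::
    "('m, 'v) vbundle \<Rightarrow> ('m \<Rightarrow> 'v \<Rightarrow> nat \<Rightarrow> real) \<Rightarrow> nat \<Rightarrow> 'm \<Rightarrow> 'v" where
  "frame A \<Phi> a p = inv_into (fibre A p) (\<Phi> p) (\<lambda>i. if i = a then 1 else 0)"

definition vector_bundle ::
    "'m::{t2_space,second_countable_topology} manifold \<Rightarrow> ('m, 'v::real_vector) vbundle \<Rightarrow> bool"
  where
  "vector_bundle M A \<longleftrightarrow>
     (\<forall>p. subspace (fibre A p)) \<and>
     (\<Union>(U, \<Phi>)\<in>trivs A. U) = UNIV \<and>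
     (\<forall>(U, \<Phi>)\<in>trivs A. open U \<and>
        (\<forall>p\<in>U. bij_betw (\<Phi> p) (fibre A p) (topspace (Euclidean_space (rk A))) \<and>
           (\<forall>v\<in>fibre A p. \<forall>w\<in>fibre A p. \<forall>a b.
              \<Phi> p (a *\<^sub>R v + b *\<^sub>R w) = (\<lambda>i. a * \<Phi> p v i + b * \<Phi> p w i)))) \<and>
     (\<forall>(U, \<Phi>)\<in>trivs A. \<forall>(V, \<Psi>)\<in>trivs A. \<forall>a<rk A. \<forall>b<rk A.
        smooth_fun_on M (U \<inter> V) (\<lambda>p. \<Psi> p (frame A \<Phi> a p) b))"

definition sections ::
    "'m::{t2_space,second_countable_topology} manifold \<Rightarrow> ('m, 'v::real_vector) vbundle
      \<Rightarrow> ('m \<Rightarrow> 'v) set" where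
  "sections M A =
     {X. (\<forall>p. X p \<in> fibre A p) \<and>
         (\<forall>(U, \<Phi>)\<in>trivs A. \<forall>a<rk A. smooth_fun_on M U (\<lambda>p. \<Phi> p (X p) a))}"

text \<open>Elements of a dual fibre are extended by \<open>0\<close> outside the fibre, so that equality of
  sections of the dual bundle is equality in HOL. Smoothness is smoothness of the components with
  respect to the dual local frames.\<close>

definition dual_fibre :: "('m, 'v::real_vector) vbundle \<Rightarrow> 'm \<Rightarrow> ('v \<Rightarrow> real) set" where
  "dual_fibre A p =
     {l. (\<forall>v\<in>fibre A p. \<forall>w\<in>fibre A p. \<forall>a b. l (a *\<^sub>R v + b *\<^sub>R w) = a * l v + b * l w) \<and>
         (\<forall>v. v \<notin> fibre A p \<longrightarrow> l v = 0)}"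

definition dual_sections ::
    "'m::{t2_space,second_countable_topology} manifold \<Rightarrow> ('m, 'v::real_vector) vbundle
      \<Rightarrow> ('m \<Rightarrow> 'v \<Rightarrow> real) set" where
  "dual_sections M A =
     {\<zeta>. (\<forall>p. \<zeta> p \<in> dual_fibre A p) \<and>
         (\<forall>(U, \<Phi>)\<in>trivs A. \<forall>a<rk A. smooth_fun_on M U (\<lambda>p. \<zeta> p (frame A \<Phi> a p)))}"

definition pairing :: "('m \<Rightarrow> 'v) \<Rightarrow> ('m \<Rightarrow> 'v \<Rightarrow> real) \<Rightarrow> 'm \<Rightarrow> real" where
  "pairing X \<zeta> = (\<lambda>p. \<zeta> p (X p))"

text \<open>Smoothness of the bundle morphism \<open>\<rho>\<close> from \<open>A\<close> to \<open>TM\<close> is expressed by the images of the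
  local frames being smooth local vector fields.\<close>

definition anchored_bundle ::
    "'m::{t2_space,second_countable_topology} manifold \<Rightarrow> ('m, 'v::real_vector) vbundle
      \<Rightarrow> ('m \<Rightarrow> 'v \<Rightarrow> ('m \<Rightarrow> real) \<Rightarrow> real) \<Rightarrow> bool" where
  "anchored_bundle M A \<rho> \<longleftrightarrow>
     vector_bundle M A \<and>
     (\<forall>p. \<forall>v\<in>fibre A p. \<rho> p v \<in> tangent_space M p) \<and>
     (\<forall>p. \<forall>v\<in>fibre A p. \<forall>w\<in>fibre A p. \<forall>a b.
        \<rho> p (a *\<^sub>R v + b *\<^sub>R w) = (\<lambda>f. a * \<rho> p v f + b * \<rho> p w f)) \<and>
     (\<forall>(U, \<Phi>)\<in>trivs A. \<forall>a<rk A. \<forall>f\<in>smooth_funs M.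
        smooth_fun_on M U (\<lambda>p. \<rho> p (frame A \<Phi> a p) f))"

section \<open>Differential operators and their duals\<close>

definition diff_operator ::
    "'m::{t2_space,second_countable_topology} manifold \<Rightarrow> ('m, 'v::real_vector) vbundle
      \<Rightarrow> (('m \<Rightarrow> 'v) \<Rightarrow> 'm \<Rightarrow> 'v) \<Rightarrow> 'm vfield \<Rightarrow> bool" where
  "diff_operator M A D Dh \<longleftrightarrow>
     (\<forall>X\<in>sections M A. D X \<in> sections M A) \<and>
     (\<forall>X\<in>sections M A. \<forall>Y\<in>sections M A. \<forall>a b.
        D (\<lambda>p. a *\<^sub>R X p + b *\<^sub>R Y p) = (\<lambda>p. a *\<^sub>R D X p + b *\<^sub>R D Y p)) \<and>
     Dh \<in> vector_fields M \<and>
     (\<forall>f\<in>smooth_funs M. \<forall>Y\<in>sections M A.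
        D (\<lambda>p. f p *\<^sub>R Y p) = (\<lambda>p. f p *\<^sub>R D Y p + vf_app Dh f p *\<^sub>R Y p))"

text \<open>The defining equation determines the section \<open>Ds \<zeta>\<close> of the dual bundle for every
  section \<open>\<zeta>\<close> of it.\<close>

definition dual_operator ::
    "'m::{t2_space,second_countable_topology} manifold \<Rightarrow> ('m, 'v::real_vector) vbundle
      \<Rightarrow> (('m \<Rightarrow> 'v) \<Rightarrow> 'm \<Rightarrow> 'v) \<Rightarrow> 'm vfield
      \<Rightarrow> (('m \<Rightarrow> 'v \<Rightarrow> real) \<Rightarrow> 'm \<Rightarrow> 'v \<Rightarrow> real) \<Rightarrow> bool" where
  "dual_operator M A D Dh Ds \<longleftrightarrow>
     (\<forall>\<zeta>\<in>dual_sections M A. Ds \<zeta> \<in> dual_sections M A \<and>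
        (\<forall>X\<in>sections M A.
           pairing X (Ds \<zeta>) = (\<lambda>p. vf_app Dh (pairing X \<zeta>) p - pairing (D X) \<zeta> p)))"

section \<open>3-Lie algebroids\<close>

text \<open>Skew-symmetric bilinear maps \<open>anc\<close> on sections are identified with linear maps on the
  second exterior power: \<open>anc X Y\<close> is the value at \<open>X \<and> Y\<close>.\<close>

definition three_anchor ::
    "'m::{t2_space,second_countable_topology} manifold \<Rightarrow> ('m, 'v::real_vector) vbundle
      \<Rightarrow> (('m \<Rightarrow> 'v) \<Rightarrow> ('m \<Rightarrow> 'v) \<Rightarrow> 'm vfield) \<Rightarrow> bool" where
  "three_anchor M A anc \<longleftrightarrow>
     (\<forall>X\<in>sections M A. \<forall>Y\<in>sections M A. anc X Y \<in> vector_fields M) \<and>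
     (\<forall>X\<in>sections M A. \<forall>Y\<in>sections M A. anc X Y = (\<lambda>p u. - anc Y X p u)) \<and>
     (\<forall>X\<in>sections M A. \<forall>Y\<in>sections M A. \<forall>Z\<in>sections M A.
      \<forall>f\<in>smooth_funs M. \<forall>g\<in>smooth_funs M.
        anc (\<lambda>p. f p *\<^sub>R X p + g p *\<^sub>R Y p) Z = (\<lambda>p u. f p * anc X Z p u + g p * anc Y Z p u) \<and>
        anc Z (\<lambda>p. f p *\<^sub>R X p + g p *\<^sub>R Y p) = (\<lambda>p u. f p * anc Z X p u + g p * anc Z Y p u))"

definition skew_trilinear ::
    "'m::{t2_space,second_countable_topology} manifold \<Rightarrow> ('m, 'v::real_vector) vbundle
      \<Rightarrow> (('m \<Rightarrow> 'v) \<Rightarrow> ('m \<Rightarrow> 'v) \<Rightarrow> ('m \<Rightarrow> 'v) \<Rightarrow> 'm \<Rightarrow> 'v) \<Rightarrow> bool" where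
  "skew_trilinear M A br \<longleftrightarrow>
     (\<forall>X\<in>sections M A. \<forall>Y\<in>sections M A. \<forall>Z\<in>sections M A.
        br X Y Z \<in> sections M A \<and>
        br X Y Z = (\<lambda>p. - br Y X Z p) \<and>
        br X Y Z = (\<lambda>p. - br X Z Y p)) \<and>
     (\<forall>X\<in>sections M A. \<forall>X'\<in>sections M A. \<forall>Y\<in>sections M A. \<forall>Z\<in>sections M A. \<forall>a b.
        br (\<lambda>p. a *\<^sub>R X p + b *\<^sub>R X' p) Y Z = (\<lambda>p. a *\<^sub>R br X Y Z p + b *\<^sub>R br X' Y Z p) \<and>
        br Y (\<lambda>p. a *\<^sub>R X p + b *\<^sub>R X' p) Z = (\<lambda>p. a *\<^sub>R br Y X Z p + b *\<^sub>R br Y X' Z p) \<and>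
        br Y Z (\<lambda>p. a *\<^sub>R X p + b *\<^sub>R X' p) = (\<lambda>p. a *\<^sub>R br Y Z X p + b *\<^sub>R br Y Z X' p))"

definition three_lie_algebroid ::
    "'m::{t2_space,second_countable_topology} manifold \<Rightarrow> ('m, 'v::real_vector) vbundle
      \<Rightarrow> (('m \<Rightarrow> 'v) \<Rightarrow> ('m \<Rightarrow> 'v) \<Rightarrow> 'm vfield)
      \<Rightarrow> (('m \<Rightarrow> 'v) \<Rightarrow> ('m \<Rightarrow> 'v) \<Rightarrow> ('m \<Rightarrow> 'v) \<Rightarrow> 'm \<Rightarrow> 'v) \<Rightarrow> bool" where
  "three_lie_algebroid M A anc br \<longleftrightarrow>
     smooth_manifold M \<and> vector_bundle M A \<and> three_anchor M A anc \<and> skew_trilinear M A br \<and>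
     (\<forall>X1\<in>sections M A. \<forall>X2\<in>sections M A.
      \<forall>Y1\<in>sections M A. \<forall>Y2\<in>sections M A. \<forall>Y3\<in>sections M A.
        br X1 X2 (br Y1 Y2 Y3) =
          (\<lambda>p. br (br X1 X2 Y1) Y2 Y3 p + br Y1 (br X1 X2 Y2) Y3 p + br Y1 Y2 (br X1 X2 Y3) p)) \<and>
     (\<forall>X1\<in>sections M A. \<forall>X2\<in>sections M A. \<forall>Y\<in>sections M A. \<forall>f\<in>smooth_funs M.
        br X1 X2 (\<lambda>p. f p *\<^sub>R Y p) =
          (\<lambda>p. f p *\<^sub>R br X1 X2 Y p + vf_app (anc X1 X2) f p *\<^sub>R Y p)) \<and>
     (\<forall>X1\<in>sections M A. \<forall>X2\<in>sections M A. \<forall>Y1\<in>sections M A. \<forall>Y2\<in>sections M A.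
        (\<lambda>p u. anc (br X1 X2 Y1) Y2 p u + anc Y1 (br X1 X2 Y2) p u) =
          lie_bracket (anc X1 X2) (anc Y1 Y2))"

section \<open>The 3-anchor and bracket induced by differential operators\<close>

text \<open>Index conventions: \<open>h i j s\<close> is \<open>h_{ij}^s\<close>, and the component \<open>X^i\<close> is \<open>pairing X (\<xi> i)\<close>.\<close>

definition op_anchor ::
    "'i set \<Rightarrow> ('i \<Rightarrow> 'm vfield) \<Rightarrow> ('i \<Rightarrow> 'm \<Rightarrow> 'v \<Rightarrow> real) \<Rightarrow> ('i \<Rightarrow> 'i \<Rightarrow> 'i \<Rightarrow> 'm \<Rightarrow> real)
      \<Rightarrow> ('m \<Rightarrow> 'v) \<Rightarrow> ('m \<Rightarrow> 'v) \<Rightarrow> 'm vfield" where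
  "op_anchor I Dh \<xi> h X Y =
     (\<lambda>p u. \<Sum>i\<in>I. \<Sum>j\<in>I. \<Sum>s\<in>I. pairing X (\<xi> i) p * pairing Y (\<xi> j) p * h i j s p * Dh s p u)"

definition op_nabla ::
    "'i set \<Rightarrow> ('i \<Rightarrow> ('m \<Rightarrow> 'v) \<Rightarrow> 'm \<Rightarrow> 'v::real_vector) \<Rightarrow> ('i \<Rightarrow> 'm \<Rightarrow> 'v \<Rightarrow> real)
      \<Rightarrow> ('i \<Rightarrow> 'i \<Rightarrow> 'i \<Rightarrow> 'm \<Rightarrow> real)
      \<Rightarrow> ('m \<Rightarrow> 'v) \<Rightarrow> ('m \<Rightarrow> 'v) \<Rightarrow> ('m \<Rightarrow> 'v) \<Rightarrow> 'm \<Rightarrow> 'v" where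
  "op_nabla I D \<xi> h X Y Z =
     (\<lambda>p. \<Sum>i\<in>I. \<Sum>j\<in>I. \<Sum>s\<in>I.
        (pairing X (\<xi> i) p * pairing Y (\<xi> j) p * h i j s p) *\<^sub>R D s Z p)"

definition op_bracket ::
    "'i set \<Rightarrow> ('i \<Rightarrow> ('m \<Rightarrow> 'v) \<Rightarrow> 'm \<Rightarrow> 'v::real_vector) \<Rightarrow> ('i \<Rightarrow> 'm \<Rightarrow> 'v \<Rightarrow> real)
      \<Rightarrow> ('i \<Rightarrow> 'i \<Rightarrow> 'i \<Rightarrow> 'm \<Rightarrow> real)
      \<Rightarrow> ('m \<Rightarrow> 'v) \<Rightarrow> ('m \<Rightarrow> 'v) \<Rightarrow> ('m \<Rightarrow> 'v) \<Rightarrow> 'm \<Rightarrow> 'v" where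
  "op_bracket I D \<xi> h X Y Z =
     (\<lambda>p. op_nabla I D \<xi> h X Y Z p + op_nabla I D \<xi> h Z X Y p + op_nabla I D \<xi> h Y Z X p)"

end

theory Submission
  imports Defs
begin

text \<open>
  Put \<open>H^s(X, Y) = X^i Y^j h_{ij}^s\<close>. Then \<open>\<nabla>_{X \<and> Y} Z\<close> is \<open>H^s(X, Y) D_s Z\<close>, and the 3-anchor
  at \<open>X \<and> Y\<close> is the combination of the symbols with the same coefficients \<open>H^s(X, Y)\<close>. So
  skew-symmetry, linearity and the Leibniz rule are inherited from the skew-symmetric bilinear
  forms \<open>H^s\<close> and from the operators. The three conditions on \<open>h\<close> become three properties of
  these forms:

  \<^item> \<open>H^s(X, Y) H^t(Z, W)\<close> is symmetric in \<open>s\<close> and \<open>t\<close> (lemma \<open>contraction_exchange\<close>);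

  \<^item> \<open>H^t(Z, W) H^s(X, Y) + H^t(X, W) H^s(Y, Z) + H^t(Y, W) H^s(Z, X) = 0\<close>
    (lemma \<open>contraction_pluecker\<close>);

  \<^item> the forms are parallel, that is, the symbol of \<open>D_r\<close> sends \<open>H^t(X, Y)\<close> to
    \<open>H^t(D_r X, Y) + H^t(X, D_r Y)\<close> (lemma \<open>Dh_contraction\<close>): the functions \<open>g\<close> that the dual operators
    produce cancel against those in the derivative of \<open>h\<close>.

  By the third property, both sides of the fundamental identity expand into sums over two indices
  \<open>s\<close> and \<open>t\<close> of the vectors \<open>D_s (D_t Z)\<close> and \<open>D_t Z\<close>, where \<open>Z\<close> runs through the five sections,
  and the coefficients are quadratic in the forms. The coefficients agree for each pair
  \<open>(s, t)\<close> (lemma \<open>fundamental_identity_coefficients\<close>): the second-order terms by the first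
  property, which makes the noncommutativity of the operators harmless, and everything that
  occurs on one side only drops out by the quadratic relation. The compatibility of the 3-anchor
  with the bracket is the same computation with functions in place of sections (lemma
  \<open>anchor_coefficients\<close>).

  The analytic part consists in showing that all these expressions are smooth. Smooth functions
  form an algebra and smoothness is local; a pairing of smooth sections is smooth because it is a
  sum of products of components over each trivializing set.
\<close>

section \<open>Algebra and locality of smooth functions\<close>

text \<open>Moving a coordinate of index below \<open>n\<close> does not leave \<open>R^n\<close>, so an open subset of \<open>R^n\<close> contains
  a piece of each coordinate line through its points. Hence partial derivatives at a point of such
  a subset see only the values on the subset.\<close>

lemma eventually_line_in_openin:
  assumes "openin (Euclidean_space n) V" "x \<in> V" "i < n"
  shows "\<forall>\<^sub>F t in nhds (x i). x(i := t) \<in> V"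
proof -
  obtain T where T: "open T" "V = T \<inter> {y. \<forall>i\<ge>n. y i = 0}"
    using assms(1) by (auto simp: Euclidean_space_def openin_subtopology euclidean_product_topology)
  have "continuous_on UNIV (\<lambda>t. x(i := t))"
  proof (rule continuous_on_coordinatewise_then_product)
    show "continuous_on UNIV (\<lambda>t. (x(i := t)) j)" for j
      by (cases "j = i") (simp_all add: continuous_on_id)
  qed
  then have "open ((\<lambda>t. x(i := t)) -` T)"
    using T(1) by (rule open_vimage[rotated])
  moreover have "x i \<in> (\<lambda>t. x(i := t)) -` T" using assms(2) T by simp
  moreover have "x(i := t) \<in> V" if "t \<in> (\<lambda>t. x(i := t)) -` T" for t
    using that assms(2,3) T by auto
  ultimately show ?thesis unfolding eventually_nhds by blast
qed

text \<open>Two functions on a manifold that agree on a domain have coordinate representations that agree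
  only on the chart image, whereas \<^const>\<open>partial_deriv\<close> is formed from functions on the whole
  space. Openness of \<open>V\<close> bridges the gap, as derivatives depend only on germs.\<close>

lemma Ck_on_cong:
  assumes "openin (Euclidean_space n) V" "\<And>x. x \<in> V \<Longrightarrow> f x = f' x"
  shows "Ck_on k n V f \<longleftrightarrow> Ck_on k n V f'"
  using assms(2)
proof (induction k arbitrary: f f')
  case 0
  then show ?case by (simp cong: continuous_on_cong)
next
  case (Suc k)
  have ev: "\<forall>\<^sub>F t in nhds (x i). f (x(i := t)) = f' (x(i := t))" if "x \<in> V" "i < n" for x i
    by (rule eventually_mono[OF eventually_line_in_openin[OF assms(1) that]]) (rule Suc.prems)
  have "(\<lambda>t. f (x(i := t))) differentiable (at (x i)) \<longleftrightarrow>
        (\<lambda>t. f' (x(i := t))) differentiable (at (x i))" if "x \<in> V" "i < n" for x i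
    unfolding real_differentiable_def using DERIV_cong_ev[OF refl ev[OF that] refl] by simp
  moreover have "Ck_on k n V (partial_deriv i f) \<longleftrightarrow> Ck_on k n V (partial_deriv i f')"
    if "i < n" for i
    by (rule Suc.IH) (simp add: partial_deriv_def deriv_cong_ev[OF ev[OF _ that] refl])
  moreover have "continuous_on V f \<longleftrightarrow> continuous_on V f'"
    using Suc.prems by (simp cong: continuous_on_cong)
  ultimately show ?case by auto
qed

lemma Ck_on_Suc_DERIV:
  assumes "Ck_on (Suc k) n V f" "x \<in> V" "i < n"
  shows "((\<lambda>t. f (x(i := t))) has_real_derivative partial_deriv i f x) (at (x i))"
  using assms by (simp add: partial_deriv_def DERIV_deriv_iff_real_differentiable)

text \<open>Introduction rule that leaves the choice of a formula for the partial derivatives, which has to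
  be right only on \<open>V\<close>.\<close>

lemma Ck_on_SucI:
  assumes "openin (Euclidean_space n) V" "continuous_on V f"
    and D: "\<And>i x. \<lbrakk>i < n; x \<in> V\<rbrakk> \<Longrightarrow>
          ((\<lambda>t. f (x(i := t))) has_real_derivative f' i x) (at (x i))"
    and C: "\<And>i. i < n \<Longrightarrow> Ck_on k n V (f' i)"
  shows "Ck_on (Suc k) n V f"
proof -
  have "Ck_on k n V (partial_deriv i f)" if i: "i < n" for i
  proof -
    have "partial_deriv i f x = f' i x" if "x \<in> V" for x
      unfolding partial_deriv_def by (rule DERIV_imp_deriv[OF D[OF i that]])
    then show ?thesis using Ck_on_cong[OF assms(1)] C[OF i] by blast
  qed
  then show ?thesis using assms(2) D by (auto simp: real_differentiable_def)
qed

lemma Ck_on_SucD: "Ck_on (Suc k) n V f \<Longrightarrow> Ck_on k n V f"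
  by (induction k arbitrary: f) auto

lemma Ck_on_imp_continuous_on: "Ck_on k n V f \<Longrightarrow> continuous_on V f"
  by (cases k) auto

lemma Ck_on_const:
  assumes "openin (Euclidean_space n) V"
  shows "Ck_on k n V (\<lambda>x. c)"
proof (induction k arbitrary: c)
  case (Suc k)
  show ?case
    by (rule Ck_on_SucI[OF assms _ _ Suc[of 0]]) auto
qed auto

lemma Ck_on_add:
  assumes "openin (Euclidean_space n) V" "Ck_on k n V f" "Ck_on k n V f'"
  shows "Ck_on k n V (\<lambda>x. f x + f' x)"
  using assms(2,3)
proof (induction k arbitrary: f f')
  case 0
  then show ?case by (simp add: continuous_on_add)
next
  case (Suc k)
  show ?case
  proof (rule Ck_on_SucI[OF assms(1)])
    show "continuous_on V (\<lambda>x. f x + f' x)"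
      using Suc.prems by (intro continuous_on_add) auto
    show "((\<lambda>t. f (x(i := t)) + f' (x(i := t))) has_real_derivative
        partial_deriv i f x + partial_deriv i f' x) (at (x i))" if "i < n" "x \<in> V" for i x
      using that Suc.prems by (intro DERIV_add Ck_on_Suc_DERIV)
    show "Ck_on k n V (\<lambda>x. partial_deriv i f x + partial_deriv i f' x)" if "i < n" for i
      using that Suc.prems by (intro Suc.IH) auto
  qed
qed

lemma Ck_on_mult:
  assumes "openin (Euclidean_space n) V" "Ck_on k n V f" "Ck_on k n V f'"
  shows "Ck_on k n V (\<lambda>x. f x * f' x)"
  using assms(2,3)
proof (induction k arbitrary: f f')
  case 0
  then show ?case by (simp add: continuous_on_mult)
next
  case (Suc k)
  show ?case
  proof (rule Ck_on_SucI[OF assms(1)])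
    show "continuous_on V (\<lambda>x. f x * f' x)"
      using Suc.prems by (intro continuous_on_mult) auto
    show "((\<lambda>t. f (x(i := t)) * f' (x(i := t))) has_real_derivative
        partial_deriv i f x * f' x + partial_deriv i f' x * f x) (at (x i))"
      if "i < n" "x \<in> V" for i x
      using DERIV_mult[OF Ck_on_Suc_DERIV[OF Suc.prems(1) that(2,1)]
          Ck_on_Suc_DERIV[OF Suc.prems(2) that(2,1)]] by (simp only: fun_upd_triv)
    show "Ck_on k n V (\<lambda>x. partial_deriv i f x * f' x + partial_deriv i f' x * f x)"
      if "i < n" for i
      using that Suc.prems Ck_on_SucD[OF Suc.prems(1)] Ck_on_SucD[OF Suc.prems(2)]
      by (intro Ck_on_add assms(1) Suc.IH) auto
  qed
qed

lemma Ck_on_subset: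
  assumes "Ck_on k n V f" "W \<subseteq> V"
  shows "Ck_on k n W f"
  using assms(1)
proof (induction k arbitrary: f)
  case 0
  then show ?case using continuous_on_subset[OF _ assms(2)] by simp
next
  case (Suc k)
  then show ?case
    unfolding Ck_on.simps using continuous_on_subset[OF _ assms(2)] assms(2) by blast
qed

text \<open>Since \<open>R^n\<close> carries the subspace topology, \<open>W\<close> is the trace of an open set, and near \<open>x\<close> the
  sets \<open>V\<close> and \<open>W\<close> have the same points.\<close>

lemma continuous_on_openin_locally:
  assumes V: "openin (Euclidean_space n) V"
    and loc: "\<And>x. x \<in> V \<Longrightarrow>
      \<exists>W. openin (Euclidean_space n) W \<and> x \<in> W \<and> W \<subseteq> V \<and> continuous_on W f"
  shows "continuous_on V f"
proof -
  have "continuous (at x within V) f" if x: "x \<in> V" for x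
  proof -
    obtain W where W: "openin (Euclidean_space n) W" "x \<in> W" "W \<subseteq> V" "continuous_on W f"
      using loc[OF x] by auto
    obtain T where T: "open T" "W = T \<inter> {y. \<forall>i\<ge>n. y i = 0}"
      using W(1) by (auto simp: Euclidean_space_def openin_subtopology euclidean_product_topology)
    have "V \<subseteq> {y. \<forall>i\<ge>n. y i = 0}"
      using openin_subset[OF V] by (simp add: topspace_Euclidean_space)
    then have "at x within V = at x within W"
      using T W(2,3) by (intro at_within_nhd[of x T]) auto
    then show ?thesis
      using W(2,4) by (simp add: continuous_on_eq_continuous_within)
  qed
  then show ?thesis by (simp add: continuous_on_eq_continuous_within)
qed

lemma Ck_on_locally:
  assumes V: "openin (Euclidean_space n) V"
    and "\<And>x. x \<in> V \<Longrightarrow> \<exists>W. openin (Euclidean_space n) W \<and> x \<in> W \<and> W \<subseteq> V \<and> Ck_on k n W f"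
  shows "Ck_on k n V f"
  using assms(2)
proof (induction k arbitrary: f)
  case 0
  show ?case
    using 0 unfolding Ck_on.simps by (rule continuous_on_openin_locally[OF V])
next
  case (Suc k)
  have "continuous_on V f"
  proof (rule continuous_on_openin_locally[OF V])
    fix x assume "x \<in> V"
    from Suc.prems[OF this]
    show "\<exists>W. openin (Euclidean_space n) W \<and> x \<in> W \<and> W \<subseteq> V \<and> continuous_on W f"
      using Ck_on_imp_continuous_on by blast
  qed
  moreover have "(\<lambda>t. f (x(i := t))) differentiable (at (x i))" if "i < n" "x \<in> V" for i x
    using Suc.prems[OF that(2)] that by auto
  moreover have "Ck_on k n V (partial_deriv i f)" if "i < n" for i
  proof (rule Suc.IH)
    fix x assume "x \<in> V"
    from Suc.prems[OF this]
    show "\<exists>W. openin (Euclidean_space n) W \<and> x \<in> W \<and> W \<subseteq> V \<and> Ck_on k n W (partial_deriv i f)"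
      unfolding Ck_on.simps using that by blast
  qed
  ultimately show ?case by simp
qed

lemma chart_image_openin:
  assumes "smooth_manifold M" "(U, \<phi>) \<in> charts M" "open W"
  shows "openin (Euclidean_space (mdim M)) (\<phi> ` (U \<inter> W))"
proof -
  have h: "homeomorphism U (\<phi> ` U) \<phi> (inv_into U \<phi>)"
    and o: "openin (Euclidean_space (mdim M)) (\<phi> ` U)"
    using assms(1,2) unfolding smooth_manifold_def by auto
  have "openin (top_of_set (\<phi> ` U)) (\<phi> ` (U \<inter> W))"
    by (rule homeomorphism_imp_open_map[OF h]) (simp add: assms(3) openin_open_Int)
  then obtain T where T: "open T" "\<phi> ` (U \<inter> W) = \<phi> ` U \<inter> T" unfolding openin_open by auto
  moreover obtain S where "open S" "\<phi> ` U = S \<inter> {y. \<forall>i\<ge>mdim M. y i = 0}"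
    using o by (auto simp: Euclidean_space_def openin_subtopology euclidean_product_topology)
  ultimately show ?thesis
    by (auto simp: Euclidean_space_def openin_subtopology euclidean_product_topology
        intro!: exI[of _ "S \<inter> T"])
qed

lemma smooth_fun_onI:
  assumes "\<And>U \<phi> k. (U, \<phi>) \<in> charts M \<Longrightarrow>
    Ck_on k (mdim M) (\<phi> ` (U \<inter> W)) (\<lambda>x. f (inv_into U \<phi> x))"
  shows "smooth_fun_on M W f"
  using assms unfolding smooth_fun_on_def Cinf_on_def by auto

lemma smooth_fun_onD:
  assumes "smooth_fun_on M W f" "(U, \<phi>) \<in> charts M"
  shows "Ck_on k (mdim M) (\<phi> ` (U \<inter> W)) (\<lambda>x. f (inv_into U \<phi> x))"
  using assms unfolding smooth_fun_on_def Cinf_on_def by blast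

lemma smooth_fun_on_const:
  assumes "smooth_manifold M" "open W"
  shows "smooth_fun_on M W (\<lambda>p. c)"
  by (rule smooth_fun_onI) (intro Ck_on_const chart_image_openin[OF assms(1) _ assms(2)])

lemma smooth_fun_on_add:
  assumes "smooth_manifold M" "open W" "smooth_fun_on M W f" "smooth_fun_on M W f'"
  shows "smooth_fun_on M W (\<lambda>p. f p + f' p)"
  by (rule smooth_fun_onI)
    (intro Ck_on_add chart_image_openin[OF assms(1) _ assms(2)] smooth_fun_onD[OF assms(3)]
      smooth_fun_onD[OF assms(4)])

lemma smooth_fun_on_mult:
  assumes "smooth_manifold M" "open W" "smooth_fun_on M W f" "smooth_fun_on M W f'"
  shows "smooth_fun_on M W (\<lambda>p. f p * f' p)"
  by (rule smooth_fun_onI)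
    (intro Ck_on_mult chart_image_openin[OF assms(1) _ assms(2)] smooth_fun_onD[OF assms(3)]
      smooth_fun_onD[OF assms(4)])

lemma smooth_fun_on_sum:
  assumes "smooth_manifold M" "open W" "\<And>s. s \<in> S \<Longrightarrow> smooth_fun_on M W (f s)"
  shows "smooth_fun_on M W (\<lambda>p. \<Sum>s\<in>S. f s p)"
  using assms(3)
  by (induction S rule: infinite_finite_induct)
    (auto intro: smooth_fun_on_const[OF assms(1,2)] smooth_fun_on_add[OF assms(1,2)])

lemma smooth_fun_on_subset:
  assumes "smooth_fun_on M W f" "W' \<subseteq> W"
  shows "smooth_fun_on M W' f"
  by (rule smooth_fun_onI, rule Ck_on_subset, rule smooth_fun_onD[OF assms(1)])
    (use assms(2) in auto)

lemma smooth_fun_on_cong: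
  assumes "smooth_manifold M" "open W" "smooth_fun_on M W f" "\<And>p. p \<in> W \<Longrightarrow> f p = f' p"
  shows "smooth_fun_on M W f'"
proof (rule smooth_fun_onI)
  fix U \<phi> k assume U: "(U, \<phi>) \<in> charts M"
  have inv: "inv_into U \<phi> (\<phi> p) = p" if "p \<in> U" for p
  proof -
    have "homeomorphism U (\<phi> ` U) \<phi> (inv_into U \<phi>)"
      using assms(1) U unfolding smooth_manifold_def by blast
    then show ?thesis using that by (rule homeomorphism_apply1)
  qed
  have eq: "f (inv_into U \<phi> x) = f' (inv_into U \<phi> x)" if "x \<in> \<phi> ` (U \<inter> W)" for x
    using that by (auto simp: inv assms(4))
  show "Ck_on k (mdim M) (\<phi> ` (U \<inter> W)) (\<lambda>x. f' (inv_into U \<phi> x))"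
    using Ck_on_cong[OF chart_image_openin[OF assms(1) U assms(2)] eq]
      smooth_fun_onD[OF assms(3) U] by (rule iffD1)
qed

text \<open>Smoothness of a global function may be checked on an open cover. This is needed because a pairing
  of sections has a formula in terms of smooth components only over each trivializing set.\<close>

lemma smooth_funs_locally:
  assumes M: "smooth_manifold M" and "\<Union>\<W> = UNIV"
    and loc: "\<And>W. W \<in> \<W> \<Longrightarrow> open W \<and> smooth_fun_on M W f"
  shows "f \<in> smooth_funs M"
  unfolding smooth_funs_def
proof (rule CollectI, rule smooth_fun_onI)
  fix U \<phi> k assume U: "(U, \<phi>) \<in> charts M"
  show "Ck_on k (mdim M) (\<phi> ` (U \<inter> UNIV)) (\<lambda>x. f (inv_into U \<phi> x))"
  proof (rule Ck_on_locally)
    show "openin (Euclidean_space (mdim M)) (\<phi> ` (U \<inter> UNIV))"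
      by (rule chart_image_openin[OF M U open_UNIV])
    fix x assume "x \<in> \<phi> ` (U \<inter> UNIV)"
    then obtain p where p: "p \<in> U" "x = \<phi> p" by blast
    have "p \<in> \<Union>\<W>" using assms(2) by simp
    then obtain W where W: "W \<in> \<W>" "p \<in> W" by (rule UnionE)
    show "\<exists>W. openin (Euclidean_space (mdim M)) W \<and> x \<in> W \<and> W \<subseteq> \<phi> ` (U \<inter> UNIV) \<and>
        Ck_on k (mdim M) W (\<lambda>x. f (inv_into U \<phi> x))"
    proof (intro exI conjI)
      show "openin (Euclidean_space (mdim M)) (\<phi> ` (U \<inter> W))"
        using loc[OF W(1)] by (intro chart_image_openin[OF M U]) simp
      show "x \<in> \<phi> ` (U \<inter> W)" using p W(2) by simp
      show "\<phi> ` (U \<inter> W) \<subseteq> \<phi> ` (U \<inter> UNIV)" by blast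
      show "Ck_on k (mdim M) (\<phi> ` (U \<inter> W)) (\<lambda>x. f (inv_into U \<phi> x))"
        using loc[OF W(1)] by (intro smooth_fun_onD[OF _ U]) simp
    qed
  qed
qed

section \<open>Sections, pairings and tangent vectors\<close>

text \<open>Trivializations and elements of dual fibres are linear only on the fibre, so the rules for maps
  that are linear on a whole type do not apply to them.\<close>

lemma linear_on_subspace_sum:
  fixes L :: "'v::real_vector \<Rightarrow> real"
  assumes V: "subspace V"
    and L: "\<And>v w a b. \<lbrakk>v \<in> V; w \<in> V\<rbrakk> \<Longrightarrow> L (a *\<^sub>R v + b *\<^sub>R w) = a * L v + b * L w"
    and w: "\<And>s. s \<in> S \<Longrightarrow> w s \<in> V"
  shows "L (\<Sum>s\<in>S. c s *\<^sub>R w s) = (\<Sum>s\<in>S. c s * L (w s))"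
proof -
  have 0: "L 0 = 0" using L[of 0 0 0 0] subspace_0[OF V] by simp
  have add: "L (v + w) = L v + L w" if "v \<in> V" "w \<in> V" for v w
    using L[OF that, of 1 1] by simp
  have scale: "L (a *\<^sub>R v) = a * L v" if "v \<in> V" for a v
    using L[OF that that, of a 0] by simp
  show ?thesis using w
    by (induction S rule: infinite_finite_induct)
      (simp_all add: 0 add scale subspace_sum[OF V] subspace_scale[OF V])
qed

lemma vector_bundle_fibre: "vector_bundle M A \<Longrightarrow> subspace (fibre A p)"
  unfolding vector_bundle_def by simp

lemma vector_bundle_cover: "vector_bundle M A \<Longrightarrow> \<Union> (fst ` trivs A) = UNIV"
  unfolding vector_bundle_def by (simp add: case_prod_unfold)

lemma vector_bundle_triv:
  assumes "vector_bundle M A" "(U, \<Phi>) \<in> trivs A"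
  shows vector_bundle_open: "open U"
    and vector_bundle_bij: "p \<in> U \<Longrightarrow>
      bij_betw (\<Phi> p) (fibre A p) (topspace (Euclidean_space (rk A)))"
    and vector_bundle_linear: "\<lbrakk>p \<in> U; v \<in> fibre A p; w \<in> fibre A p\<rbrakk> \<Longrightarrow>
      \<Phi> p (a *\<^sub>R v + b *\<^sub>R w) i = a * \<Phi> p v i + b * \<Phi> p w i"
proof -
  have *: "open U \<and>
      (\<forall>p\<in>U. bij_betw (\<Phi> p) (fibre A p) (topspace (Euclidean_space (rk A))) \<and>
        (\<forall>v\<in>fibre A p. \<forall>w\<in>fibre A p. \<forall>a b.
          \<Phi> p (a *\<^sub>R v + b *\<^sub>R w) = (\<lambda>i. a * \<Phi> p v i + b * \<Phi> p w i)))"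
    using assms unfolding vector_bundle_def by fast
  from * show "open U" ..
  from * show "p \<in> U \<Longrightarrow> bij_betw (\<Phi> p) (fibre A p) (topspace (Euclidean_space (rk A)))"
    by blast
  from * show "\<lbrakk>p \<in> U; v \<in> fibre A p; w \<in> fibre A p\<rbrakk> \<Longrightarrow>
      \<Phi> p (a *\<^sub>R v + b *\<^sub>R w) i = a * \<Phi> p v i + b * \<Phi> p w i"
    by simp
qed

lemma sections_fibre: "X \<in> sections M A \<Longrightarrow> X p \<in> fibre A p"
  unfolding sections_def by simp

lemma sections_smooth:
  "\<lbrakk>X \<in> sections M A; (U, \<Phi>) \<in> trivs A; a < rk A\<rbrakk> \<Longrightarrow> smooth_fun_on M U (\<lambda>p. \<Phi> p (X p) a)"
  unfolding sections_def by blast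

lemma sectionsI:
  assumes "\<And>p. X p \<in> fibre A p"
    and "\<And>U \<Phi> a. \<lbrakk>(U, \<Phi>) \<in> trivs A; a < rk A\<rbrakk> \<Longrightarrow> smooth_fun_on M U (\<lambda>p. \<Phi> p (X p) a)"
  shows "X \<in> sections M A"
  using assms unfolding sections_def by blast

lemma dual_sections_linear:
  "\<lbrakk>\<zeta> \<in> dual_sections M A; v \<in> fibre A p; w \<in> fibre A p\<rbrakk> \<Longrightarrow>
    \<zeta> p (a *\<^sub>R v + b *\<^sub>R w) = a * \<zeta> p v + b * \<zeta> p w"
  unfolding dual_sections_def dual_fibre_def by simp

lemma dual_sections_smooth:
  "\<lbrakk>\<zeta> \<in> dual_sections M A; (U, \<Phi>) \<in> trivs A; a < rk A\<rbrakk> \<Longrightarrow>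
    smooth_fun_on M U (\<lambda>p. \<zeta> p (frame A \<Phi> a p))"
  unfolding dual_sections_def by blast

text \<open>The coefficients of \<open>v\<close> with respect to the local frame are the components of its image under
  the trivialization, because \<open>\<Phi> p\<close> sends the frame to the standard basis of \<open>R^r\<close> and is injective.\<close>

lemma frame_expansion:
  fixes A :: "('m::{t2_space,second_countable_topology}, 'v::real_vector) vbundle"
  assumes A: "vector_bundle M A" "(U, \<Phi>) \<in> trivs A" and p: "p \<in> U" and v: "v \<in> fibre A p"
  shows "\<And>a. a < rk A \<Longrightarrow> frame A \<Phi> a p \<in> fibre A p"
    and "v = (\<Sum>a<rk A. \<Phi> p v a *\<^sub>R frame A \<Phi> a p)"
proof -
  let ?E = "topspace (Euclidean_space (rk A))"
  note V = vector_bundle_fibre[OF A(1), of p]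
  note bij = vector_bundle_bij[OF A p]
  have E: "(\<lambda>i. if i = a then 1 else 0) \<in> ?E" if "a < rk A" for a
    using that by (auto simp: topspace_Euclidean_space)
  show fr: "frame A \<Phi> a p \<in> fibre A p" if "a < rk A" for a
    unfolding frame_def by (rule inv_into_into) (use E[OF that] bij in \<open>simp add: bij_betw_def\<close>)
  have \<Phi>fr: "\<Phi> p (frame A \<Phi> a p) = (\<lambda>i. if i = a then 1 else 0)" if "a < rk A" for a
    unfolding frame_def by (rule f_inv_into_f) (use E[OF that] bij in \<open>simp add: bij_betw_def\<close>)
  let ?w = "\<Sum>a<rk A. \<Phi> p v a *\<^sub>R frame A \<Phi> a p"
  have "\<Phi> p ?w i = \<Phi> p v i" for i
  proof -
    have "\<Phi> p ?w i = (\<Sum>a<rk A. \<Phi> p v a * \<Phi> p (frame A \<Phi> a p) i)"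
      by (rule linear_on_subspace_sum[OF V, where L = "\<lambda>v. \<Phi> p v i"])
        (simp_all add: vector_bundle_linear[OF A p] fr)
    also have "\<dots> = (\<Sum>a<rk A. if i = a then \<Phi> p v a else 0)"
      by (rule sum.cong) (auto simp: \<Phi>fr)
    also have "\<dots> = \<Phi> p v i"
      using bij_betwE[OF bij] v by (auto simp: topspace_Euclidean_space)
    finally show ?thesis .
  qed
  moreover have "?w \<in> fibre A p"
    using fr by (intro subspace_sum[OF V] subspace_scale[OF V]) auto
  ultimately show "v = ?w"
    using v by (intro inj_onD[OF bij_betw_imp_inj_on[OF bij]]) auto
qed

text \<open>Over a trivializing set, the frame expansion turns the pairing into the finite sum of products of
  the components of \<open>X\<close> and \<open>\<zeta>\<close>, which are smooth by definition.\<close>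

lemma pairing_in_smooth_funs:
  assumes M: "smooth_manifold M" and A: "vector_bundle M A"
    and X: "X \<in> sections M A" and \<zeta>: "\<zeta> \<in> dual_sections M A"
  shows "pairing X \<zeta> \<in> smooth_funs M"
proof (rule smooth_funs_locally[OF M, where \<W> = "fst ` trivs A"])
  show "\<Union> (fst ` trivs A) = UNIV" by (rule vector_bundle_cover[OF A])
  fix W assume "W \<in> fst ` trivs A"
  then obtain \<Phi> where \<Phi>: "(W, \<Phi>) \<in> trivs A" by auto
  note W = vector_bundle_open[OF A \<Phi>]
  have "smooth_fun_on M W (\<lambda>p. \<Sum>a<rk A. \<Phi> p (X p) a * \<zeta> p (frame A \<Phi> a p))"
    by (intro smooth_fun_on_sum[OF M W] smooth_fun_on_mult[OF M W]
        sections_smooth[OF X \<Phi>] dual_sections_smooth[OF \<zeta> \<Phi>]) simp_all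
  then have "smooth_fun_on M W (pairing X \<zeta>)"
  proof (rule smooth_fun_on_cong[OF M W])
    fix p assume p: "p \<in> W"
    note v = sections_fibre[OF X, of p]
    have "\<zeta> p (\<Sum>a<rk A. \<Phi> p (X p) a *\<^sub>R frame A \<Phi> a p) =
        (\<Sum>a<rk A. \<Phi> p (X p) a * \<zeta> p (frame A \<Phi> a p))"
      by (rule linear_on_subspace_sum[OF vector_bundle_fibre[OF A, of p], where L = "\<zeta> p"])
        (simp_all add: dual_sections_linear[OF \<zeta>] frame_expansion(1)[OF A \<Phi> p v])
    then show "(\<Sum>a<rk A. \<Phi> p (X p) a * \<zeta> p (frame A \<Phi> a p)) = pairing X \<zeta> p"
      unfolding pairing_def using frame_expansion(2)[OF A \<Phi> p v] by simp
  qed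
  with W show "open W \<and> smooth_fun_on M W (pairing X \<zeta>)" ..
qed

lemma sections_lincomb:
  assumes M: "smooth_manifold M" and A: "vector_bundle M A"
    and X: "X \<in> sections M A" and Y: "Y \<in> sections M A"
    and f: "f \<in> smooth_funs M" and g: "g \<in> smooth_funs M"
  shows "(\<lambda>p. f p *\<^sub>R X p + g p *\<^sub>R Y p) \<in> sections M A"
proof (rule sectionsI)
  show "f p *\<^sub>R X p + g p *\<^sub>R Y p \<in> fibre A p" for p
    by (intro subspace_add subspace_scale vector_bundle_fibre[OF A] sections_fibre[OF X]
        sections_fibre[OF Y])
  fix U \<Phi> a assume U: "(U, \<Phi>) \<in> trivs A" and a: "a < rk A"
  note o = vector_bundle_open[OF A U]
  have fg: "smooth_fun_on M U f" "smooth_fun_on M U g"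
    using f g unfolding smooth_funs_def by (simp_all add: smooth_fun_on_subset[OF _ subset_UNIV])
  have "smooth_fun_on M U (\<lambda>p. f p * \<Phi> p (X p) a + g p * \<Phi> p (Y p) a)"
    by (intro smooth_fun_on_add[OF M o] smooth_fun_on_mult[OF M o] fg
        sections_smooth[OF X U a] sections_smooth[OF Y U a])
  then show "smooth_fun_on M U (\<lambda>p. \<Phi> p (f p *\<^sub>R X p + g p *\<^sub>R Y p) a)"
    by (rule smooth_fun_on_cong[OF M o])
      (simp add: vector_bundle_linear[OF A U] sections_fibre[OF X] sections_fibre[OF Y])
qed

lemma smooth_funs_const: "smooth_manifold M \<Longrightarrow> (\<lambda>p. c) \<in> smooth_funs M"
  unfolding smooth_funs_def by (simp add: smooth_fun_on_const)

lemma smooth_funs_mult: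
  "\<lbrakk>smooth_manifold M; f \<in> smooth_funs M; f' \<in> smooth_funs M\<rbrakk> \<Longrightarrow> (\<lambda>p. f p * f' p) \<in> smooth_funs M"
  unfolding smooth_funs_def by (simp add: smooth_fun_on_mult)

lemma smooth_funs_sum:
  "\<lbrakk>smooth_manifold M; \<And>s. s \<in> S \<Longrightarrow> f s \<in> smooth_funs M\<rbrakk> \<Longrightarrow> (\<lambda>p. \<Sum>s\<in>S. f s p) \<in> smooth_funs M"
  unfolding smooth_funs_def by (simp add: smooth_fun_on_sum)

lemma zero_in_sections:
  assumes M: "smooth_manifold M" and A: "vector_bundle M A"
  shows "(\<lambda>p. 0) \<in> sections M A"
proof (rule sectionsI)
  show zero: "0 \<in> fibre A p" for p by (rule subspace_0[OF vector_bundle_fibre[OF A]])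
  fix U \<Phi> a assume U: "(U, \<Phi>) \<in> trivs A"
  note o = vector_bundle_open[OF A U]
  show "smooth_fun_on M U (\<lambda>p. \<Phi> p 0 a)"
    by (rule smooth_fun_on_cong[OF M o smooth_fun_on_const[OF M o, of 0]])
      (use vector_bundle_linear[OF A U _ zero zero, of _ 0 0] in simp)
qed

lemma sections_sum:
  assumes M: "smooth_manifold M" and A: "vector_bundle M A"
    and "\<And>s. s \<in> S \<Longrightarrow> f s \<in> smooth_funs M" "\<And>s. s \<in> S \<Longrightarrow> Z s \<in> sections M A"
  shows "(\<lambda>p. \<Sum>s\<in>S. f s p *\<^sub>R Z s p) \<in> sections M A"
  using assms(3,4)
proof (induction S rule: infinite_finite_induct)
  case (insert s S)
  then show ?case
    using sections_lincomb[OF M A, of "Z s" "\<lambda>p. \<Sum>s\<in>S. f s p *\<^sub>R Z s p" "f s" "\<lambda>p. 1"]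
    by (simp add: smooth_funs_const[OF M])
qed (simp_all add: zero_in_sections[OF M A])

lemma tangent_vector_sum:
  assumes M: "smooth_manifold M" and v: "v \<in> tangent_space M p"
    and "\<And>s. s \<in> S \<Longrightarrow> f s \<in> smooth_funs M"
  shows "v (\<lambda>q. \<Sum>s\<in>S. f s q) = (\<Sum>s\<in>S. v (f s))"
proof -
  have lin: "v (\<lambda>q. a * f q + b * g q) = a * v f + b * v g"
    if "f \<in> smooth_funs M" "g \<in> smooth_funs M" for f g a b
    using v that unfolding tangent_space_def by blast
  have 0: "v (\<lambda>q. 0) = 0"
    using lin[OF smooth_funs_const[OF M] smooth_funs_const[OF M], of 0 0 0 0] by simp
  show ?thesis using assms(3)
  proof (induction S rule: infinite_finite_induct)
    case (insert s S)
    then show ?case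
      using lin[of "f s" "\<lambda>q. \<Sum>s\<in>S. f s q" 1 1] by (simp add: smooth_funs_sum[OF M])
  qed (simp_all add: 0)
qed

lemma tangent_vector_mult:
  assumes "v \<in> tangent_space M p" "f \<in> smooth_funs M" "f' \<in> smooth_funs M"
  shows "v (\<lambda>q. f q * f' q) = f p * v f' + f' p * v f"
  using assms unfolding tangent_space_def by blast

lemma tangent_space_sum:
  assumes M: "smooth_manifold M" and "\<And>s. s \<in> S \<Longrightarrow> v s \<in> tangent_space M p"
  shows "(\<lambda>u. \<Sum>s\<in>S. c s * v s u) \<in> tangent_space M p"
proof -
  have lin: "v s (\<lambda>q. a * f q + b * g q) = a * v s f + b * v s g"
    and mult: "v s (\<lambda>q. f q * g q) = f p * v s g + g p * v s f"
    if "s \<in> S" "f \<in> smooth_funs M" "g \<in> smooth_funs M" for s f g a b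
    using assms(2) that unfolding tangent_space_def by blast+
  have out: "v s f = 0" if "s \<in> S" "f \<notin> smooth_funs M" for s f
    using assms(2) that unfolding tangent_space_def by blast
  show ?thesis
    unfolding tangent_space_def
    by (auto simp: lin mult out sum_distrib_left algebra_simps sum.distrib[symmetric]
        intro!: sum.cong)
qed

section \<open>Coefficients of the fundamental identity\<close>

text \<open>The order of summation on the right makes the index pairs \<open>(i, l)\<close> and \<open>(j, k)\<close> of the factors
  appear in it as they do in the quadratic relation between the functions \<open>h_{ij}^s\<close>; the other
  terms of that relation are reached from here by cyclic rotation of the outer three indices.\<close>

lemma sum_mult_sum_regroup:
  fixes F G :: "'i \<Rightarrow> 'i \<Rightarrow> real"
  shows "(\<Sum>i\<in>I. \<Sum>l\<in>I. F i l) * (\<Sum>j\<in>I. \<Sum>k\<in>I. G j k) =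
    (\<Sum>i\<in>I. \<Sum>j\<in>I. \<Sum>k\<in>I. \<Sum>l\<in>I. F i l * G j k)"
proof -
  have "(\<Sum>l\<in>I. F i l) * (\<Sum>j\<in>I. \<Sum>k\<in>I. G j k) = (\<Sum>j\<in>I. \<Sum>k\<in>I. \<Sum>l\<in>I. F i l * G j k)" for i
    by (simp add: sum_distrib_left sum_distrib_right)
  then show ?thesis by (simp add: sum_distrib_right)
qed

lemma sum_rotate:
  fixes F :: "'i \<Rightarrow> 'i \<Rightarrow> 'i \<Rightarrow> 'b::comm_monoid_add"
  shows "(\<Sum>a\<in>I. \<Sum>b\<in>I. \<Sum>c\<in>I. F a b c) = (\<Sum>b\<in>I. \<Sum>c\<in>I. \<Sum>a\<in>I. F a b c)"
proof -
  have "(\<Sum>a\<in>I. \<Sum>b\<in>I. \<Sum>c\<in>I. F a b c) = (\<Sum>b\<in>I. \<Sum>a\<in>I. \<Sum>c\<in>I. F a b c)"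
    by (rule sum.swap)
  also have "\<dots> = (\<Sum>b\<in>I. \<Sum>c\<in>I. \<Sum>a\<in>I. F a b c)"
    by (intro sum.cong refl sum.swap)
  finally show ?thesis .
qed

text \<open>The next three functions are the coefficients of indices \<open>s\<close> and \<open>t\<close> in the expansions of
  \<open>\<nabla>_{x \<and> y} [u, v, w]\<close>, \<open>\<nabla>_{[u, v, w] \<and> y}\<close> and \<open>\<nabla>_{x \<and> [u, v, w]}\<close>. Here \<open>H\<close> and \<open>K\<close> stand for the
  contracted forms of indices \<open>s\<close> and \<open>t\<close> at a point, \<open>d\<close> for \<open>D_s\<close>, \<open>\<tau> z\<close> for the value of
  \<open>D_t z\<close> and \<open>\<epsilon> z\<close> for that of \<open>D_s (D_t z)\<close>. In all of them \<open>D_s\<close> differentiates an argument of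
  the form of index \<open>t\<close>, while \<open>D_t\<close> acts on the section that survives; with this convention the
  identities below hold for each pair \<open>(s, t)\<close>, without interchanging the two indices.\<close>

definition outer_bracket_term ::
    "('x \<Rightarrow> 'x \<Rightarrow> real) \<Rightarrow> ('x \<Rightarrow> 'x \<Rightarrow> real) \<Rightarrow> ('x \<Rightarrow> 'x) \<Rightarrow> ('x \<Rightarrow> 'w) \<Rightarrow> ('x \<Rightarrow> 'w)
      \<Rightarrow> 'x \<Rightarrow> 'x \<Rightarrow> 'x \<Rightarrow> 'x \<Rightarrow> 'x \<Rightarrow> 'w::real_vector" where
  "outer_bracket_term H K d \<tau> \<epsilon> x y u v w = H x y *\<^sub>R
     ((K u v *\<^sub>R \<epsilon> w + (K (d u) v + K u (d v)) *\<^sub>R \<tau> w) +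
      (K w u *\<^sub>R \<epsilon> v + (K (d w) u + K w (d u)) *\<^sub>R \<tau> v) +
      (K v w *\<^sub>R \<epsilon> u + (K (d v) w + K v (d w)) *\<^sub>R \<tau> u))"

definition left_bracket_coeff ::
    "('x \<Rightarrow> 'x \<Rightarrow> real) \<Rightarrow> ('x \<Rightarrow> 'x \<Rightarrow> real) \<Rightarrow> ('x \<Rightarrow> 'x) \<Rightarrow> 'x \<Rightarrow> 'x \<Rightarrow> 'x \<Rightarrow> 'x \<Rightarrow> real" where
  "left_bracket_coeff H K d u v w y = H u v * K (d w) y + H w u * K (d v) y + H v w * K (d u) y"

definition right_bracket_coeff ::
    "('x \<Rightarrow> 'x \<Rightarrow> real) \<Rightarrow> ('x \<Rightarrow> 'x \<Rightarrow> real) \<Rightarrow> ('x \<Rightarrow> 'x) \<Rightarrow> 'x \<Rightarrow> 'x \<Rightarrow> 'x \<Rightarrow> 'x \<Rightarrow> real" where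
  "right_bracket_coeff H K d x u v w = H u v * K x (d w) + H w u * K x (d v) + H v w * K x (d u)"

text \<open>What remains of the hypotheses on \<open>h\<close> at a point, after contraction with sections: the third
  assumption says that products of contracted forms are symmetric in the upper indices, the last
  one is a three-term quadratic relation of Pluecker type. The type \<open>'x\<close> stands for
  that of sections, rather than for a fibre, so that operators can be applied to the arguments.\<close>

locale pluecker_pair =
  fixes H K :: "'x \<Rightarrow> 'x \<Rightarrow> real"
  assumes skew_H: "H x y = - H y x" and skew_K: "K x y = - K y x"
    and exchange: "H x y * K z w = K x y * H z w"
    and pluecker: "K z w * H x y + K x w * H y z + K y w * H z x = 0"
begin

text \<open>This lemma and the next are the quadratic relation in the shapes in which it occurs when \<open>w\<close> is
  the derivative of the first, respectively second, factor of \<open>x1 \<and> x2\<close>.\<close>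

lemma first_order_left:
  "H x2 a * K w b + H x2 b * K a w + H a b * K w x2 = 0"
  using pluecker[of b w a x2] skew_H[of x2 a] skew_H[of b a] skew_K[of w b] skew_K[of w x2]
  by algebra

lemma first_order_right:
  "H a x1 * K w b + H b x1 * K a w + H a b * K x1 w = 0"
  using pluecker[of b w x1 a] skew_H[of x1 a] skew_K[of w b] by algebra

text \<open>The equation between the coefficients of a section to which only one derivative is applied. The
  terms that differentiate \<open>a\<close> and \<open>b\<close> cancel; those that differentiate \<open>x1\<close> and those that
  differentiate \<open>x2\<close> are two instances of the quadratic relation.\<close>

lemma first_order:
  "H x1 x2 * (K da b + K a db) =
     H a b * (K dx1 x2 + K x1 dx2) +
     (H x1 x2 * K da b + H a x1 * K dx2 b + H x2 a * K dx1 b) +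
     (H x1 x2 * K a db + H b x1 * K a dx2 + H x2 b * K a dx1)"
  using first_order_left[of x2 a dx1 b] first_order_right[of a x1 dx2 b] by algebra

lemma second_order: "H x y * K z w = H z w * K x y"
  using exchange[of x y z w] by simp

text \<open>The coefficients are compared vector by vector. Those of \<open>\<epsilon> y1\<close>, \<open>\<epsilon> y2\<close> and \<open>\<epsilon> y3\<close> agree by
  symmetry in the upper indices, so that commutators of the operators never enter; those of
  \<open>\<tau> y1\<close>, \<open>\<tau> y2\<close> and \<open>\<tau> y3\<close> agree by lemma \<open>first_order\<close>. Only the right-hand side has terms in
  \<open>\<epsilon> x1\<close> and \<open>\<epsilon> x2\<close>, and terms in which \<open>\<tau> x1\<close> meets \<open>d x2\<close> or \<open>\<tau> x2\<close> meets \<open>d x1\<close>: their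
  coefficients are cyclic sums over \<open>y1\<close>, \<open>y2\<close>, \<open>y3\<close> that vanish by the quadratic relation.\<close>

lemma fundamental_identity_coefficients:
  fixes d :: "'x \<Rightarrow> 'x" and \<tau> \<epsilon> :: "'x \<Rightarrow> 'w::real_vector"
  defines "outer \<equiv> outer_bracket_term H K d \<tau> \<epsilon>"
    and "left \<equiv> left_bracket_coeff H K d" and "right \<equiv> right_bracket_coeff H K d"
  shows "outer x1 x2 y1 y2 y3 + left y1 y2 y3 x1 *\<^sub>R \<tau> x2 + right x2 y1 y2 y3 *\<^sub>R \<tau> x1 =
      (outer y2 y3 x1 x2 y1 + left x1 x2 y1 y2 *\<^sub>R \<tau> y3 + right y3 x1 x2 y1 *\<^sub>R \<tau> y2) +
      (outer y3 y1 x1 x2 y2 + left x1 x2 y2 y3 *\<^sub>R \<tau> y1 + right y1 x1 x2 y2 *\<^sub>R \<tau> y3) +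
      (outer y1 y2 x1 x2 y3 + left x1 x2 y3 y1 *\<^sub>R \<tau> y2 + right y2 x1 x2 y3 *\<^sub>R \<tau> y1)"
proof -
  note outer = outer_def outer_bracket_term_def
    and left = left_def left_bracket_coeff_def and right = right_def right_bracket_coeff_def
  define \<kappa> where "\<kappa> a b = left x1 x2 a b + right a x1 x2 b" for a b
  have \<tau>y: "H x1 x2 * (K (d a) b + K a (d b)) =
      H a b * (K (d x1) x2 + K x1 (d x2)) + \<kappa> a b" for a b
    unfolding \<kappa>_def left right
    using first_order[of x1 x2 "d a" b a "d b" "d x1" "d x2"] by simp
  have cyc: "H y2 y3 * K y1 w + H y3 y1 * K y2 w + H y1 y2 * K y3 w = 0" for w
    using pluecker[of y3 w y1 y2] by (simp add: algebra_simps)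
  have cyc': "H y2 y3 * K w y1 + H y3 y1 * K w y2 + H y1 y2 * K w y3 = 0" for w
    using cyc[of w] skew_K[of w y1] skew_K[of w y2] skew_K[of w y3] by simp
  have "outer x1 x2 y1 y2 y3 + left y1 y2 y3 x1 *\<^sub>R \<tau> x2 + right x2 y1 y2 y3 *\<^sub>R \<tau> x1 =
      (H x1 x2 * K y1 y2) *\<^sub>R \<epsilon> y3 + (H x1 x2 * K y3 y1) *\<^sub>R \<epsilon> y2 +
      (H x1 x2 * K y2 y3) *\<^sub>R \<epsilon> y1 +
      (H x1 x2 * (K (d y1) y2 + K y1 (d y2))) *\<^sub>R \<tau> y3 +
      (H x1 x2 * (K (d y3) y1 + K y3 (d y1))) *\<^sub>R \<tau> y2 +
      (H x1 x2 * (K (d y2) y3 + K y2 (d y3))) *\<^sub>R \<tau> y1 +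
      (H y1 y2 * K (d y3) x1 + H y3 y1 * K (d y2) x1 + H y2 y3 * K (d y1) x1) *\<^sub>R \<tau> x2 +
      (H y1 y2 * K x2 (d y3) + H y3 y1 * K x2 (d y2) + H y2 y3 * K x2 (d y1)) *\<^sub>R \<tau> x1"
    unfolding outer left right by (simp add: scaleR_add_right scaleR_add_left distrib_left)
  also have "\<dots> =
      (H y1 y2 * K x1 x2) *\<^sub>R \<epsilon> y3 + (H y3 y1 * K x1 x2) *\<^sub>R \<epsilon> y2 +
      (H y2 y3 * K x1 x2) *\<^sub>R \<epsilon> y1 +
      (H y1 y2 * (K (d x1) x2 + K x1 (d x2)) + \<kappa> y1 y2) *\<^sub>R \<tau> y3 +
      (H y3 y1 * (K (d x1) x2 + K x1 (d x2)) + \<kappa> y3 y1) *\<^sub>R \<tau> y2 +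
      (H y2 y3 * (K (d x1) x2 + K x1 (d x2)) + \<kappa> y2 y3) *\<^sub>R \<tau> y1 +
      (H y1 y2 * K (d y3) x1 + H y3 y1 * K (d y2) x1 + H y2 y3 * K (d y1) x1) *\<^sub>R \<tau> x2 +
      (H y1 y2 * K x2 (d y3) + H y3 y1 * K x2 (d y2) + H y2 y3 * K x2 (d y1)) *\<^sub>R \<tau> x1 +
      (H y2 y3 * K y1 x1 + H y3 y1 * K y2 x1 + H y1 y2 * K y3 x1) *\<^sub>R \<epsilon> x2 +
      (H y2 y3 * K x2 y1 + H y3 y1 * K x2 y2 + H y1 y2 * K x2 y3) *\<^sub>R \<epsilon> x1 +
      (H y2 y3 * K y1 (d x1) + H y3 y1 * K y2 (d x1) + H y1 y2 * K y3 (d x1)) *\<^sub>R \<tau> x2 +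
      (H y2 y3 * K (d x2) y1 + H y3 y1 * K (d x2) y2 + H y1 y2 * K (d x2) y3) *\<^sub>R \<tau> x1"
    unfolding \<tau>y cyc cyc' second_order[of x1 x2] by simp
  also have "\<dots> =
      (outer y2 y3 x1 x2 y1 + left x1 x2 y1 y2 *\<^sub>R \<tau> y3 + right y3 x1 x2 y1 *\<^sub>R \<tau> y2) +
      (outer y3 y1 x1 x2 y2 + left x1 x2 y2 y3 *\<^sub>R \<tau> y1 + right y1 x1 x2 y2 *\<^sub>R \<tau> y3) +
      (outer y1 y2 x1 x2 y3 + left x1 x2 y3 y1 *\<^sub>R \<tau> y2 + right y2 x1 x2 y3 *\<^sub>R \<tau> y1)"
    unfolding outer left right \<kappa>_def
    by (simp add: scaleR_add_right scaleR_add_left distrib_left)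
  finally show ?thesis .
qed

text \<open>The analogue for the anchor, where \<open>e\<close> is the second derivative \<open>D_s (D_t u)\<close> of a function. Its
  coefficient on the right vanishes by symmetry in the upper indices: the Lie brackets of the
  symbols cancel in the Lie bracket of two values of the anchor.\<close>

lemma anchor_coefficients:
  fixes d :: "'x \<Rightarrow> 'x" and e \<tau> :: real
  shows "left_bracket_coeff H K d x1 x2 a b * \<tau> + right_bracket_coeff H K d a x1 x2 b * \<tau> =
    H x1 x2 * (K a b * e + (K (d a) b + K a (d b)) * \<tau>) -
    H a b * (K x1 x2 * e + (K (d x1) x2 + K x1 (d x2)) * \<tau>)"
  unfolding left_bracket_coeff_def right_bracket_coeff_def
  using first_order[of x1 x2 "d a" b a "d b" "d x1" "d x2"] second_order[of x1 x2 a b]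
  by algebra

end

section \<open>The contracted forms\<close>

text \<open>The hypotheses on the dual operators enter only through the assumption \<open>Dh_pairing\<close>, their
  definition evaluated at the sections \<open>\<xi> i\<close>. It says how a symbol differentiates the component
  \<open>X^i\<close>: up to a term in the functions \<open>g\<close>, the result is the component of \<open>D_r X\<close>.\<close>

locale compatible_operators =
  fixes M :: "'m::{t2_space,second_countable_topology} manifold"
    and A :: "('m, 'v::real_vector) vbundle"
    and I :: "'i set"
    and D :: "'i \<Rightarrow> ('m \<Rightarrow> 'v) \<Rightarrow> 'm \<Rightarrow> 'v"
    and Dh :: "'i \<Rightarrow> 'm vfield"
    and \<xi> :: "'i \<Rightarrow> 'm \<Rightarrow> 'v \<Rightarrow> real"
    and g h :: "'i \<Rightarrow> 'i \<Rightarrow> 'i \<Rightarrow> 'm \<Rightarrow> real"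
  assumes M: "smooth_manifold M" and A: "vector_bundle M A"
    and D: "\<And>i. i \<in> I \<Longrightarrow> diff_operator M A (D i) (Dh i)"
    and \<xi>: "\<And>i. i \<in> I \<Longrightarrow> \<xi> i \<in> dual_sections M A"
    and Dh_pairing: "\<And>r i X p. \<lbrakk>r \<in> I; i \<in> I; X \<in> sections M A\<rbrakk> \<Longrightarrow>
      Dh r p (pairing X (\<xi> i)) = \<xi> i p (D r X p) + (\<Sum>k\<in>I. g r k i p * \<xi> k p (X p))"
    and h_smooth: "\<And>i j k. \<lbrakk>i \<in> I; j \<in> I; k \<in> I\<rbrakk> \<Longrightarrow> h i j k \<in> smooth_funs M"
    and h_skew: "\<And>i j k p. \<lbrakk>i \<in> I; j \<in> I; k \<in> I\<rbrakk> \<Longrightarrow> h i j k p = - h j i k p"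
    and h_pluecker: "\<And>i j k l r s p. \<lbrakk>i \<in> I; j \<in> I; k \<in> I; l \<in> I; r \<in> I; s \<in> I\<rbrakk> \<Longrightarrow>
      h k l r p * h i j s p + h i l r p * h j k s p + h j l r p * h k i s p = 0"
    and h_exchange: "\<And>i j k l r s p. \<lbrakk>i \<in> I; j \<in> I; k \<in> I; l \<in> I; r \<in> I; s \<in> I\<rbrakk> \<Longrightarrow>
      h i j s p * h k l r p = h i j r p * h k l s p"
    and Dh_h: "\<And>i j r t p. \<lbrakk>i \<in> I; j \<in> I; r \<in> I; t \<in> I\<rbrakk> \<Longrightarrow>
      Dh r p (h i j t) = (\<Sum>s\<in>I. g r i s p * h j s t p + g r j s p * h s i t p)"
begin

text \<open>The form \<open>H^s = h_{ij}^s \<xi>^i \<otimes> \<xi>^j\<close>. It takes vectors of the fibre as arguments, so that its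
  bilinearity over functions is bilinearity at each point.\<close>

definition contraction :: "'i \<Rightarrow> 'm \<Rightarrow> 'v \<Rightarrow> 'v \<Rightarrow> real" where
  "contraction s p v w = (\<Sum>i\<in>I. \<Sum>j\<in>I. \<xi> i p v * \<xi> j p w * h i j s p)"

abbreviation coeff :: "'i \<Rightarrow> 'm \<Rightarrow> ('m \<Rightarrow> 'v) \<Rightarrow> ('m \<Rightarrow> 'v) \<Rightarrow> real" where
  "coeff s p \<equiv> \<lambda>X Y. contraction s p (X p) (Y p)"

abbreviation "\<N> \<equiv> op_nabla I D \<xi> h"
abbreviation "\<B> \<equiv> op_bracket I D \<xi> h"

lemma op_anchor_contraction:
  "op_anchor I Dh \<xi> h X Y = (\<lambda>p u. \<Sum>s\<in>I. contraction s p (X p) (Y p) * Dh s p u)"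
proof -
  have "(\<Sum>s\<in>I. contraction s p (X p) (Y p) * Dh s p u) =
      (\<Sum>i\<in>I. \<Sum>j\<in>I. \<Sum>s\<in>I. \<xi> i p (X p) * \<xi> j p (Y p) * h i j s p * Dh s p u)" for p u
    unfolding contraction_def sum_distrib_right by (rule sum_rotate)
  then show ?thesis unfolding op_anchor_def pairing_def by simp
qed

lemma op_anchor_apply:
  "op_anchor I Dh \<xi> h X Y p u = (\<Sum>s\<in>I. coeff s p X Y * Dh s p u)"
  unfolding op_anchor_contraction ..

lemma op_nabla_contraction:
  "\<N> X Y Z = (\<lambda>p. \<Sum>s\<in>I. contraction s p (X p) (Y p) *\<^sub>R D s Z p)"
proof -
  have "(\<Sum>s\<in>I. contraction s p (X p) (Y p) *\<^sub>R D s Z p) =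
      (\<Sum>i\<in>I. \<Sum>j\<in>I. \<Sum>s\<in>I. (\<xi> i p (X p) * \<xi> j p (Y p) * h i j s p) *\<^sub>R D s Z p)" for p
    unfolding contraction_def scaleR_left.sum by (rule sum_rotate)
  then show ?thesis unfolding op_nabla_def pairing_def by simp
qed

lemma contraction_skew:
  assumes "s \<in> I"
  shows "contraction s p v w = - contraction s p w v"
proof -
  have "contraction s p v w = (\<Sum>j\<in>I. \<Sum>i\<in>I. \<xi> i p v * \<xi> j p w * h i j s p)"
    unfolding contraction_def by (rule sum.swap)
  also have "\<dots> = (\<Sum>j\<in>I. \<Sum>i\<in>I. - (\<xi> j p w * \<xi> i p v * h j i s p))"
  proof (intro sum.cong refl)
    fix j i assume "j \<in> I" "i \<in> I"
    then have "h i j s p = - h j i s p" using assms by (intro h_skew)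
    then show "\<xi> i p v * \<xi> j p w * h i j s p = - (\<xi> j p w * \<xi> i p v * h j i s p)" by simp
  qed
  finally show ?thesis unfolding contraction_def by (simp add: sum_negf)
qed

lemma contraction_exchange:
  assumes "s \<in> I" "t \<in> I"
  shows "contraction s p v w * contraction t p x y = contraction t p v w * contraction s p x y"
  unfolding contraction_def sum_mult_sum_regroup
proof (intro sum.cong refl)
  fix i j k l assume "i \<in> I" "j \<in> I" "k \<in> I" "l \<in> I"
  then have "h i l s p * h j k t p = h i l t p * h j k s p"
    using assms by (intro h_exchange)
  then show "\<xi> i p v * \<xi> l p w * h i l s p * (\<xi> j p x * \<xi> k p y * h j k t p) =
      \<xi> i p v * \<xi> l p w * h i l t p * (\<xi> j p x * \<xi> k p y * h j k s p)"
    by algebra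
qed

text \<open>Each product is a fourfold sum with the same coefficients \<open>x^i y^j z^k w^l\<close>, and the three
  summands add up to the quadratic relation for \<open>h\<close>.\<close>

lemma contraction_pluecker:
  assumes "s \<in> I" "t \<in> I"
  shows "contraction t p z w * contraction s p x y +
      contraction t p x w * contraction s p y z +
      contraction t p y w * contraction s p z x = 0"
proof -
  let ?c = "\<lambda>i j k l. \<xi> i p x * \<xi> j p y * \<xi> k p z * \<xi> l p w"
  have "contraction t p z w * contraction s p x y =
      (\<Sum>k\<in>I. \<Sum>i\<in>I. \<Sum>j\<in>I. \<Sum>l\<in>I. ?c i j k l * (h k l t p * h i j s p))"
    unfolding contraction_def sum_mult_sum_regroup by (simp add: mult_ac)
  also have "\<dots> = (\<Sum>i\<in>I. \<Sum>j\<in>I. \<Sum>k\<in>I. \<Sum>l\<in>I. ?c i j k l * (h k l t p * h i j s p))"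
    by (rule sum_rotate)
  finally have 1: "contraction t p z w * contraction s p x y = \<dots>" .
  have 2: "contraction t p x w * contraction s p y z =
      (\<Sum>i\<in>I. \<Sum>j\<in>I. \<Sum>k\<in>I. \<Sum>l\<in>I. ?c i j k l * (h i l t p * h j k s p))"
    unfolding contraction_def sum_mult_sum_regroup by (simp add: mult_ac)
  have "contraction t p y w * contraction s p z x =
      (\<Sum>j\<in>I. \<Sum>k\<in>I. \<Sum>i\<in>I. \<Sum>l\<in>I. ?c i j k l * (h j l t p * h k i s p))"
    unfolding contraction_def sum_mult_sum_regroup by (simp add: mult_ac)
  also have "\<dots> = (\<Sum>i\<in>I. \<Sum>j\<in>I. \<Sum>k\<in>I. \<Sum>l\<in>I. ?c i j k l * (h j l t p * h k i s p))"
    by (rule sum_rotate[symmetric])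
  finally have 3: "contraction t p y w * contraction s p z x = \<dots>" .
  show ?thesis
    unfolding 1 2 3 sum.distrib[symmetric] distrib_left[symmetric]
  proof (intro sum.neutral ballI)
    fix i j k l assume "i \<in> I" "j \<in> I" "k \<in> I" "l \<in> I"
    then show "?c i j k l *
        (h k l t p * h i j s p + h i l t p * h j k s p + h j l t p * h k i s p) = 0"
      using assms by (simp only: h_pluecker mult_zero_right)
  qed
qed

lemma contraction_linear_left:
  assumes "s \<in> I" "v \<in> fibre A p" "w \<in> fibre A p"
  shows "contraction s p (a *\<^sub>R v + b *\<^sub>R w) x = a * contraction s p v x + b * contraction s p w x"
  unfolding contraction_def sum_distrib_left sum.distrib[symmetric]
  using assms by (intro sum.cong refl) (simp add: dual_sections_linear[OF \<xi>] algebra_simps)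

lemma contraction_linear_right:
  assumes "s \<in> I" "v \<in> fibre A p" "w \<in> fibre A p"
  shows "contraction s p x (a *\<^sub>R v + b *\<^sub>R w) = a * contraction s p x v + b * contraction s p x w"
  using contraction_linear_left[OF assms, of a b x] contraction_skew[OF assms(1), of p x]
  by (simp add: algebra_simps)

lemma contraction_sum_left:
  assumes "t \<in> I" "\<And>s. s \<in> S \<Longrightarrow> w s \<in> fibre A p"
  shows "contraction t p (\<Sum>s\<in>S. c s *\<^sub>R w s) x = (\<Sum>s\<in>S. c s * contraction t p (w s) x)"
  by (rule linear_on_subspace_sum[OF vector_bundle_fibre[OF A, of p], where L = "\<lambda>v. contraction t p v x"])
    (simp_all add: contraction_linear_left assms)

lemma Dh_vector_field: "s \<in> I \<Longrightarrow> Dh s \<in> vector_fields M"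
  using D unfolding diff_operator_def by blast

lemma Dh_tangent: "s \<in> I \<Longrightarrow> Dh s p \<in> tangent_space M p"
  using Dh_vector_field unfolding vector_fields_def by blast

lemma Dh_smooth: "\<lbrakk>s \<in> I; u \<in> smooth_funs M\<rbrakk> \<Longrightarrow> vf_app (Dh s) u \<in> smooth_funs M"
  using Dh_vector_field unfolding vector_fields_def by blast

lemma D_sections: "\<lbrakk>s \<in> I; X \<in> sections M A\<rbrakk> \<Longrightarrow> D s X \<in> sections M A"
  using D unfolding diff_operator_def by blast

lemma D_lincomb:
  assumes "s \<in> I" "X \<in> sections M A" "Y \<in> sections M A"
  shows "D s (\<lambda>p. a *\<^sub>R X p + b *\<^sub>R Y p) = (\<lambda>p. a *\<^sub>R D s X p + b *\<^sub>R D s Y p)"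
  using D[OF assms(1)] assms(2,3) unfolding diff_operator_def by blast

lemma D_add:
  assumes "s \<in> I" "X \<in> sections M A" "Y \<in> sections M A"
  shows "D s (\<lambda>p. X p + Y p) p = D s X p + D s Y p"
  using D_lincomb[OF assms, of 1 1] by simp

lemma D_scale:
  assumes "s \<in> I" "f \<in> smooth_funs M" "Y \<in> sections M A"
  shows "D s (\<lambda>p. f p *\<^sub>R Y p) p = f p *\<^sub>R D s Y p + Dh s p f *\<^sub>R Y p"
  using D[OF assms(1)] assms(2,3) unfolding diff_operator_def vf_app_def by simp

lemma D_sum:
  assumes r: "r \<in> I" and "\<And>s. s \<in> S \<Longrightarrow> f s \<in> smooth_funs M" "\<And>s. s \<in> S \<Longrightarrow> Z s \<in> sections M A"
  shows "D r (\<lambda>p. \<Sum>s\<in>S. f s p *\<^sub>R Z s p) p =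
    (\<Sum>s\<in>S. f s p *\<^sub>R D r (Z s) p + Dh r p (f s) *\<^sub>R Z s p)"
proof -
  note Z0 = zero_in_sections[OF M A]
  have 0: "D r (\<lambda>p. 0) p = 0"
    using D_lincomb[OF r Z0 Z0, of 0 0] by simp
  show ?thesis using assms(2,3)
  proof (induction S rule: infinite_finite_induct)
    case (insert s S)
    have "D r (\<lambda>p. f s p *\<^sub>R Z s p + (\<Sum>s\<in>S. f s p *\<^sub>R Z s p)) p =
        D r (\<lambda>p. f s p *\<^sub>R Z s p) p + D r (\<lambda>p. \<Sum>s\<in>S. f s p *\<^sub>R Z s p) p"
      using insert.prems sections_sum[OF M A, of "{s}" f Z]
      by (intro D_add r sections_sum[OF M A]) auto
    then show ?case using insert by (simp add: D_scale[OF r])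
  qed (simp_all add: 0)
qed

lemma contraction_smooth:
  assumes "s \<in> I" "X \<in> sections M A" "Y \<in> sections M A"
  shows "(\<lambda>p. contraction s p (X p) (Y p)) \<in> smooth_funs M"
proof -
  have "(\<lambda>p. \<Sum>i\<in>I. \<Sum>j\<in>I. pairing X (\<xi> i) p * pairing Y (\<xi> j) p * h i j s p) \<in> smooth_funs M"
    using assms by (intro smooth_funs_sum[OF M] smooth_funs_mult[OF M] h_smooth
        pairing_in_smooth_funs[OF M A] \<xi>)
  then show ?thesis unfolding contraction_def pairing_def .
qed

text \<open>The forms \<open>H^t\<close> are parallel: differentiating \<open>X^i Y^j h_{ij}^t\<close> by the product rule yields the two
  terms on the right, together with terms in \<open>g\<close> from \<open>X^i\<close> and from \<open>Y^j\<close>. After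
  renaming summation indices, the latter are cancelled by the prescribed derivative of \<open>h_{ij}^t\<close>,
  by skew-symmetry of \<open>h\<close>.\<close>

lemma Dh_contraction:
  assumes r: "r \<in> I" and t: "t \<in> I" and X: "X \<in> sections M A" and Y: "Y \<in> sections M A"
  shows "Dh r p (\<lambda>q. contraction t q (X q) (Y q)) =
    contraction t p (D r X p) (Y p) + contraction t p (X p) (D r Y p)"
proof -
  let ?x = "\<lambda>i. \<xi> i p (X p)" and ?y = "\<lambda>j. \<xi> j p (Y p)"
  have sm: "pairing X (\<xi> i) \<in> smooth_funs M" "pairing Y (\<xi> i) \<in> smooth_funs M" if "i \<in> I" for i
    using that X Y by (auto intro: pairing_in_smooth_funs[OF M A] \<xi>)
  have "Dh r p (\<lambda>q. contraction t q (X q) (Y q)) =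
      Dh r p (\<lambda>q. \<Sum>i\<in>I. \<Sum>j\<in>I. pairing X (\<xi> i) q * pairing Y (\<xi> j) q * h i j t q)"
    unfolding contraction_def pairing_def ..
  also have "\<dots> = (\<Sum>i\<in>I. Dh r p (\<lambda>q. \<Sum>j\<in>I. pairing X (\<xi> i) q * pairing Y (\<xi> j) q * h i j t q))"
    using t by (intro tangent_vector_sum[OF M Dh_tangent[OF r]] smooth_funs_sum[OF M]
        smooth_funs_mult[OF M] sm h_smooth)
  also have "\<dots> = (\<Sum>i\<in>I. \<Sum>j\<in>I. Dh r p (\<lambda>q. pairing X (\<xi> i) q * pairing Y (\<xi> j) q * h i j t q))"
    using t by (intro sum.cong refl tangent_vector_sum[OF M Dh_tangent[OF r]]
        smooth_funs_mult[OF M] sm h_smooth)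
  also have "\<dots> = (\<Sum>i\<in>I. \<Sum>j\<in>I.
      \<xi> i p (D r X p) * ?y j * h i j t p + ?x i * \<xi> j p (D r Y p) * h i j t p +
      ((\<Sum>k\<in>I. g r k i p * ?x k * ?y j * h i j t p) +
       (\<Sum>k\<in>I. g r k j p * ?x i * ?y k * h i j t p) +
       (\<Sum>k\<in>I. ?x i * ?y j * (g r i k p * h j k t p + g r j k p * h k i t p))))"
  proof (intro sum.cong refl)
    fix i j assume ij: "i \<in> I" "j \<in> I"
    have "Dh r p (\<lambda>q. pairing X (\<xi> i) q * pairing Y (\<xi> j) q * h i j t q) =
        ?x i * ?y j * Dh r p (h i j t) +
        h i j t p * (?x i * Dh r p (pairing Y (\<xi> j)) + ?y j * Dh r p (pairing X (\<xi> i)))"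
      using ij t by (simp add: tangent_vector_mult[OF Dh_tangent[OF r]] sm h_smooth
          smooth_funs_mult[OF M]) (simp add: pairing_def)
    then show "Dh r p (\<lambda>q. pairing X (\<xi> i) q * pairing Y (\<xi> j) q * h i j t q) =
        \<xi> i p (D r X p) * ?y j * h i j t p + ?x i * \<xi> j p (D r Y p) * h i j t p +
        ((\<Sum>k\<in>I. g r k i p * ?x k * ?y j * h i j t p) +
         (\<Sum>k\<in>I. g r k j p * ?x i * ?y k * h i j t p) +
         (\<Sum>k\<in>I. ?x i * ?y j * (g r i k p * h j k t p + g r j k p * h k i t p)))"
      unfolding Dh_h[OF ij r t] Dh_pairing[OF r ij(1) X] Dh_pairing[OF r ij(2) Y]
      by (simp add: algebra_simps sum_distrib_left)
  qed
  also have "\<dots> = contraction t p (D r X p) (Y p) + contraction t p (X p) (D r Y p) +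
      ((\<Sum>i\<in>I. \<Sum>j\<in>I. \<Sum>k\<in>I. g r k i p * ?x k * ?y j * h i j t p) +
       (\<Sum>i\<in>I. \<Sum>j\<in>I. \<Sum>k\<in>I. g r k j p * ?x i * ?y k * h i j t p) +
       (\<Sum>i\<in>I. \<Sum>j\<in>I. \<Sum>k\<in>I. ?x i * ?y j * (g r i k p * h j k t p + g r j k p * h k i t p)))"
    unfolding contraction_def by (simp only: sum.distrib)
  also have "(\<Sum>i\<in>I. \<Sum>j\<in>I. \<Sum>k\<in>I. g r k i p * ?x k * ?y j * h i j t p) =
      (\<Sum>i\<in>I. \<Sum>j\<in>I. \<Sum>k\<in>I. g r i k p * ?x i * ?y j * h k j t p)"
  proof -
    have "(\<Sum>i\<in>I. \<Sum>j\<in>I. \<Sum>k\<in>I. g r k i p * ?x k * ?y j * h i j t p) =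
        (\<Sum>j\<in>I. \<Sum>k\<in>I. \<Sum>i\<in>I. g r k i p * ?x k * ?y j * h i j t p)"
      by (rule sum_rotate)
    also have "\<dots> = (\<Sum>k\<in>I. \<Sum>j\<in>I. \<Sum>i\<in>I. g r k i p * ?x k * ?y j * h i j t p)"
      by (rule sum.swap)
    finally show ?thesis .
  qed
  also have "(\<Sum>i\<in>I. \<Sum>j\<in>I. \<Sum>k\<in>I. g r k j p * ?x i * ?y k * h i j t p) =
      (\<Sum>i\<in>I. \<Sum>j\<in>I. \<Sum>k\<in>I. g r j k p * ?x i * ?y j * h i k t p)"
    by (intro sum.cong refl sum.swap)
  also have "(\<Sum>i\<in>I. \<Sum>j\<in>I. \<Sum>k\<in>I. g r i k p * ?x i * ?y j * h k j t p) +
      (\<Sum>i\<in>I. \<Sum>j\<in>I. \<Sum>k\<in>I. g r j k p * ?x i * ?y j * h i k t p) +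
      (\<Sum>i\<in>I. \<Sum>j\<in>I. \<Sum>k\<in>I. ?x i * ?y j * (g r i k p * h j k t p + g r j k p * h k i t p)) = 0"
    unfolding sum.distrib[symmetric]
  proof (intro sum.neutral ballI)
    fix i j k assume "i \<in> I" "j \<in> I" "k \<in> I"
    then show "g r i k p * ?x i * ?y j * h k j t p + g r j k p * ?x i * ?y j * h i k t p +
        ?x i * ?y j * (g r i k p * h j k t p + g r j k p * h k i t p) = 0"
      using h_skew[of k j t p] h_skew[of i k t p] t by (simp add: algebra_simps)
  qed
  finally show ?thesis by simp
qed

section \<open>The induced anchor and bracket\<close>

lemma op_nabla_sections:
  assumes "X \<in> sections M A" "Y \<in> sections M A" "Z \<in> sections M A"
  shows "\<N> X Y Z \<in> sections M A"
  unfolding op_nabla_contraction using assms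
  by (intro sections_sum[OF M A] contraction_smooth D_sections)

lemma sections_add:
  "\<lbrakk>X \<in> sections M A; Y \<in> sections M A\<rbrakk> \<Longrightarrow> (\<lambda>p. X p + Y p) \<in> sections M A"
  using sections_lincomb[OF M A, of X Y "\<lambda>p. 1" "\<lambda>p. 1"] smooth_funs_const[OF M] by simp

lemma op_bracket_sections:
  assumes "X \<in> sections M A" "Y \<in> sections M A" "Z \<in> sections M A"
  shows "\<B> X Y Z \<in> sections M A"
  unfolding op_bracket_def using assms by (intro sections_add op_nabla_sections)

lemma op_nabla_skew: "\<N> X Y Z p = - \<N> Y X Z p"
  unfolding op_nabla_contraction sum_negf[symmetric]
  by (intro sum.cong refl) (simp add: contraction_skew[of _ p "X p" "Y p"])

lemma D_nabla:
  assumes "s \<in> I" "X \<in> sections M A" "Y \<in> sections M A" "Z \<in> sections M A"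
  shows "D s (\<N> X Y Z) p = (\<Sum>t\<in>I. contraction t p (X p) (Y p) *\<^sub>R D s (D t Z) p +
    (contraction t p (D s X p) (Y p) + contraction t p (X p) (D s Y p)) *\<^sub>R D t Z p)"
  unfolding op_nabla_contraction using assms
  by (subst D_sum) (auto simp: contraction_smooth D_sections Dh_contraction)

lemma D_bracket:
  assumes s: "s \<in> I" and "X \<in> sections M A" "Y \<in> sections M A" "Z \<in> sections M A"
  shows "D s (\<B> X Y Z) p = D s (\<N> X Y Z) p + D s (\<N> Z X Y) p + D s (\<N> Y Z X) p"
  unfolding op_bracket_def using assms
  by (simp add: D_add[OF s] sections_add op_nabla_sections)

lemma contraction_nabla_left:
  assumes "t \<in> I" "X \<in> sections M A" "Y \<in> sections M A" "Z \<in> sections M A"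
  shows "contraction t p (\<N> X Y Z p) w =
    (\<Sum>s\<in>I. contraction s p (X p) (Y p) * contraction t p (D s Z p) w)"
  unfolding op_nabla_contraction
  using assms by (intro contraction_sum_left sections_fibre[OF D_sections])

lemma coeff_bracket_left:
  assumes t: "t \<in> I" and "U \<in> sections M A" "V \<in> sections M A" "W \<in> sections M A"
  shows "coeff t p (\<B> U V W) Y =
    (\<Sum>s\<in>I. left_bracket_coeff (coeff s p) (coeff t p) (D s) U V W Y)"
proof -
  have add: "contraction t p (v + v') w = contraction t p v w + contraction t p v' w"
    if "v \<in> fibre A p" "v' \<in> fibre A p" for v v' w
    using contraction_linear_left[OF t that, of 1 1] by simp
  show ?thesis
    unfolding op_bracket_def left_bracket_coeff_def sum.distrib using assms
    by (simp add: add contraction_nabla_left sections_fibre[OF op_nabla_sections]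
        subspace_add[OF vector_bundle_fibre[OF A]])
qed

lemma coeff_bracket_right:
  assumes t: "t \<in> I" and "U \<in> sections M A" "V \<in> sections M A" "W \<in> sections M A"
  shows "coeff t p X (\<B> U V W) =
    (\<Sum>s\<in>I. right_bracket_coeff (coeff s p) (coeff t p) (D s) X U V W)"
proof -
  have "coeff t p X (\<B> U V W) =
      - (\<Sum>s\<in>I. left_bracket_coeff (coeff s p) (coeff t p) (D s) U V W X)"
    using contraction_skew[OF t, of p "X p"] coeff_bracket_left[OF assms, of p X] by simp
  also have "\<dots> = (\<Sum>s\<in>I. right_bracket_coeff (coeff s p) (coeff t p) (D s) X U V W)"
    unfolding sum_negf[symmetric] left_bracket_coeff_def right_bracket_coeff_def
      contraction_skew[OF t, of p "X p"]
    by simp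
  finally show ?thesis .
qed

text \<open>In this lemma and the next two, the order of the sums is chosen such that \<open>t\<close> always is the index
  of the operator that acts on the surviving section.\<close>

lemma nabla_of_bracket:
  assumes "U \<in> sections M A" "V \<in> sections M A" "W \<in> sections M A"
  shows "\<N> X Y (\<B> U V W) p = (\<Sum>s\<in>I. \<Sum>t\<in>I. outer_bracket_term (coeff s p) (coeff t p) (D s)
    (\<lambda>Z. D t Z p) (\<lambda>Z. D s (D t Z) p) X Y U V W)"
  unfolding op_nabla_contraction[of X Y] outer_bracket_term_def scaleR_right.sum[symmetric]
  by (intro sum.cong refl) (simp only: D_bracket[OF _ assms] D_nabla assms sum.distrib)

lemma nabla_along_bracket_left:
  assumes "U \<in> sections M A" "V \<in> sections M A" "W \<in> sections M A"
  shows "\<N> (\<B> U V W) Y Z p =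
    (\<Sum>s\<in>I. \<Sum>t\<in>I. left_bracket_coeff (coeff s p) (coeff t p) (D s) U V W Y *\<^sub>R D t Z p)"
proof -
  have "\<N> (\<B> U V W) Y Z p =
      (\<Sum>t\<in>I. \<Sum>s\<in>I. left_bracket_coeff (coeff s p) (coeff t p) (D s) U V W Y *\<^sub>R D t Z p)"
    unfolding op_nabla_contraction[of _ Y] scaleR_left.sum[symmetric]
    by (intro sum.cong refl) (simp only: coeff_bracket_left[OF _ assms])
  also note sum.swap
  finally show ?thesis .
qed

lemma nabla_along_bracket_right:
  assumes "U \<in> sections M A" "V \<in> sections M A" "W \<in> sections M A"
  shows "\<N> X (\<B> U V W) Z p =
    (\<Sum>s\<in>I. \<Sum>t\<in>I. right_bracket_coeff (coeff s p) (coeff t p) (D s) X U V W *\<^sub>R D t Z p)"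
proof -
  have "\<N> X (\<B> U V W) Z p =
      (\<Sum>t\<in>I. \<Sum>s\<in>I. right_bracket_coeff (coeff s p) (coeff t p) (D s) X U V W *\<^sub>R D t Z p)"
    unfolding op_nabla_contraction[of X] scaleR_left.sum[symmetric]
    by (intro sum.cong refl) (simp only: coeff_bracket_right[OF _ assms])
  also note sum.swap
  finally show ?thesis .
qed

lemma pluecker_pair_coeff:
  assumes "s \<in> I" "t \<in> I"
  shows "pluecker_pair (coeff s p) (coeff t p)"
  by unfold_locales
    (rule contraction_skew contraction_exchange contraction_pluecker; rule assms)+

lemma fundamental_identity:
  assumes X: "X1 \<in> sections M A" "X2 \<in> sections M A"
    and Y: "Y1 \<in> sections M A" "Y2 \<in> sections M A" "Y3 \<in> sections M A"
  shows "\<B> X1 X2 (\<B> Y1 Y2 Y3) p =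
    \<B> (\<B> X1 X2 Y1) Y2 Y3 p + \<B> Y1 (\<B> X1 X2 Y2) Y3 p + \<B> Y1 Y2 (\<B> X1 X2 Y3) p"
proof -
  have "\<N> X1 X2 (\<B> Y1 Y2 Y3) p + \<N> (\<B> Y1 Y2 Y3) X1 X2 p + \<N> X2 (\<B> Y1 Y2 Y3) X1 p =
     (\<N> Y2 Y3 (\<B> X1 X2 Y1) p + \<N> (\<B> X1 X2 Y1) Y2 Y3 p + \<N> Y3 (\<B> X1 X2 Y1) Y2 p) +
     (\<N> Y3 Y1 (\<B> X1 X2 Y2) p + \<N> (\<B> X1 X2 Y2) Y3 Y1 p + \<N> Y1 (\<B> X1 X2 Y2) Y3 p) +
     (\<N> Y1 Y2 (\<B> X1 X2 Y3) p + \<N> (\<B> X1 X2 Y3) Y1 Y2 p + \<N> Y2 (\<B> X1 X2 Y3) Y1 p)"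
    unfolding nabla_of_bracket[OF Y] nabla_along_bracket_left[OF Y] nabla_along_bracket_right[OF Y]
      nabla_of_bracket[OF X Y(1)] nabla_of_bracket[OF X Y(2)] nabla_of_bracket[OF X Y(3)]
      nabla_along_bracket_left[OF X Y(1)] nabla_along_bracket_left[OF X Y(2)]
      nabla_along_bracket_left[OF X Y(3)] nabla_along_bracket_right[OF X Y(1)]
      nabla_along_bracket_right[OF X Y(2)] nabla_along_bracket_right[OF X Y(3)]
      sum.distrib[symmetric]
    by (intro sum.cong refl pluecker_pair.fundamental_identity_coefficients pluecker_pair_coeff)
  then show ?thesis unfolding op_bracket_def[of _ _ _ _ X1 X2 "\<B> Y1 Y2 Y3"]
      op_bracket_def[of _ _ _ _ "\<B> X1 X2 Y1"]
      op_bracket_def[of _ _ _ _ Y1 "\<B> X1 X2 Y2"] op_bracket_def[of _ _ _ _ Y1 Y2 "\<B> X1 X2 Y3"]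
    by (simp only: add_ac)
qed

lemma Dh_anchor:
  assumes s: "s \<in> I" and X: "X \<in> sections M A" and Y: "Y \<in> sections M A"
    and u: "u \<in> smooth_funs M"
  shows "Dh s p (vf_app (op_anchor I Dh \<xi> h X Y) u) =
    (\<Sum>t\<in>I. coeff t p X Y * Dh s p (vf_app (Dh t) u) +
      (coeff t p (D s X) Y + coeff t p X (D s Y)) * Dh t p u)"
proof -
  have "Dh s p (vf_app (op_anchor I Dh \<xi> h X Y) u) =
      Dh s p (\<lambda>q. \<Sum>t\<in>I. contraction t q (X q) (Y q) * vf_app (Dh t) u q)"
    unfolding op_anchor_contraction vf_app_def ..
  also have "\<dots> = (\<Sum>t\<in>I. Dh s p (\<lambda>q. contraction t q (X q) (Y q) * vf_app (Dh t) u q))"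
    using X Y u
    by (intro tangent_vector_sum[OF M Dh_tangent[OF s]] smooth_funs_mult[OF M] contraction_smooth
        Dh_smooth)
  also have "\<dots> = (\<Sum>t\<in>I. coeff t p X Y * Dh s p (vf_app (Dh t) u) +
      (coeff t p (D s X) Y + coeff t p X (D s Y)) * Dh t p u)"
    using X Y u s
    by (intro sum.cong refl) (simp add: tangent_vector_mult[OF Dh_tangent[OF s]] contraction_smooth
        Dh_smooth Dh_contraction, simp add: vf_app_def)
  finally show ?thesis .
qed

text \<open>Both sides are compared as derivations applied to \<open>u\<close>. Vector fields are extended by \<open>0\<close> to
  functions that are not smooth, and so for such \<open>u\<close> both sides vanish.\<close>

lemma anchor_bracket:
  assumes X: "X1 \<in> sections M A" "X2 \<in> sections M A"
    and Y: "Y1 \<in> sections M A" "Y2 \<in> sections M A"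
  shows "op_anchor I Dh \<xi> h (\<B> X1 X2 Y1) Y2 p u + op_anchor I Dh \<xi> h Y1 (\<B> X1 X2 Y2) p u =
    lie_bracket (op_anchor I Dh \<xi> h X1 X2) (op_anchor I Dh \<xi> h Y1 Y2) p u"
proof (cases "u \<in> smooth_funs M")
  case True
  have "op_anchor I Dh \<xi> h (\<B> X1 X2 Y1) Y2 p u + op_anchor I Dh \<xi> h Y1 (\<B> X1 X2 Y2) p u =
      (\<Sum>t\<in>I. \<Sum>s\<in>I. left_bracket_coeff (coeff s p) (coeff t p) (D s) X1 X2 Y1 Y2 * Dh t p u +
        right_bracket_coeff (coeff s p) (coeff t p) (D s) Y1 X1 X2 Y2 * Dh t p u)"
    unfolding op_anchor_contraction[of _ Y2] op_anchor_contraction[of Y1] sum.distrib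
      sum_distrib_right[symmetric]
    using coeff_bracket_left[OF _ X Y(1)] coeff_bracket_right[OF _ X Y(2)] by simp
  also have "\<dots> = (\<Sum>s\<in>I. \<Sum>t\<in>I.
      left_bracket_coeff (coeff s p) (coeff t p) (D s) X1 X2 Y1 Y2 * Dh t p u +
        right_bracket_coeff (coeff s p) (coeff t p) (D s) Y1 X1 X2 Y2 * Dh t p u)"
    by (rule sum.swap)
  also have "\<dots> = (\<Sum>s\<in>I. \<Sum>t\<in>I.
      coeff s p X1 X2 * (coeff t p Y1 Y2 * Dh s p (vf_app (Dh t) u) +
        (coeff t p (D s Y1) Y2 + coeff t p Y1 (D s Y2)) * Dh t p u) -
      coeff s p Y1 Y2 * (coeff t p X1 X2 * Dh s p (vf_app (Dh t) u) +
        (coeff t p (D s X1) X2 + coeff t p X1 (D s X2)) * Dh t p u))"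
    by (intro sum.cong refl pluecker_pair.anchor_coefficients pluecker_pair_coeff)
  also have "\<dots> = lie_bracket (op_anchor I Dh \<xi> h X1 X2) (op_anchor I Dh \<xi> h Y1 Y2) p u"
    by (simp only: lie_bracket_def op_anchor_apply Dh_anchor X Y True sum_subtractf
        sum_distrib_left cong: sum.cong)
  finally show ?thesis .
next
  case False
  have 0: "Dh s q u = 0" if "s \<in> I" for s q
    using Dh_tangent[OF that] False unfolding tangent_space_def by blast
  then have anchor0: "op_anchor I Dh \<xi> h X Y q u = 0" for X Y q
    unfolding op_anchor_contraction by simp
  have "Dh s p (\<lambda>q. 0) = 0" if "s \<in> I" for s
    using tangent_vector_sum[OF M Dh_tangent[OF that], of "{}"] by simp
  then have "op_anchor I Dh \<xi> h X Y p (\<lambda>q. 0) = 0" for X Y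
    unfolding op_anchor_contraction by simp
  then show ?thesis
    unfolding lie_bracket_def vf_app_def anchor0 by simp
qed

lemma anchor_vector_field:
  assumes X: "X \<in> sections M A" and Y: "Y \<in> sections M A"
  shows "op_anchor I Dh \<xi> h X Y \<in> vector_fields M"
proof -
  have "op_anchor I Dh \<xi> h X Y p \<in> tangent_space M p" for p
    unfolding op_anchor_contraction by (rule tangent_space_sum[OF M Dh_tangent])
  moreover have "vf_app (op_anchor I Dh \<xi> h X Y) f \<in> smooth_funs M" if f: "f \<in> smooth_funs M" for f
  proof -
    have "(\<lambda>p. \<Sum>s\<in>I. contraction s p (X p) (Y p) * vf_app (Dh s) f p) \<in> smooth_funs M"
      using X Y f by (intro smooth_funs_sum[OF M] smooth_funs_mult[OF M] contraction_smooth Dh_smooth)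
    then show ?thesis unfolding op_anchor_contraction vf_app_def .
  qed
  ultimately show ?thesis unfolding vector_fields_def by blast
qed

lemma three_anchor: "three_anchor M A (op_anchor I Dh \<xi> h)"
  unfolding three_anchor_def
proof (intro conjI ballI ext)
  fix X Y Z f f' p u
  assume X: "X \<in> sections M A" and Y: "Y \<in> sections M A"
  show "op_anchor I Dh \<xi> h X Y \<in> vector_fields M" by (rule anchor_vector_field[OF X Y])
  show "op_anchor I Dh \<xi> h X Y p u = - op_anchor I Dh \<xi> h Y X p u"
    unfolding op_anchor_contraction sum_negf[symmetric]
    by (intro sum.cong refl) (simp add: contraction_skew[of _ p "X p" "Y p"])
  show "op_anchor I Dh \<xi> h (\<lambda>p. f p *\<^sub>R X p + f' p *\<^sub>R Y p) Z p u =
      f p * op_anchor I Dh \<xi> h X Z p u + f' p * op_anchor I Dh \<xi> h Y Z p u"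
    unfolding op_anchor_contraction sum_distrib_left sum.distrib[symmetric]
    using X Y by (intro sum.cong refl)
      (simp add: contraction_linear_left sections_fibre distrib_right mult.assoc)
  show "op_anchor I Dh \<xi> h Z (\<lambda>p. f p *\<^sub>R X p + f' p *\<^sub>R Y p) p u =
      f p * op_anchor I Dh \<xi> h Z X p u + f' p * op_anchor I Dh \<xi> h Z Y p u"
    unfolding op_anchor_contraction sum_distrib_left sum.distrib[symmetric]
    using X Y by (intro sum.cong refl)
      (simp add: contraction_linear_right sections_fibre distrib_right mult.assoc)
qed

lemma nabla_linear_left:
  assumes "X \<in> sections M A" "Y \<in> sections M A"
  shows "\<N> (\<lambda>p. f p *\<^sub>R X p + f' p *\<^sub>R Y p) W Z p = f p *\<^sub>R \<N> X W Z p + f' p *\<^sub>R \<N> Y W Z p"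
  unfolding op_nabla_contraction scaleR_right.sum sum.distrib[symmetric]
  using assms by (intro sum.cong refl)
    (simp add: contraction_linear_left sections_fibre scaleR_add_left)

lemma nabla_linear_right:
  assumes "X \<in> sections M A" "Y \<in> sections M A"
  shows "\<N> W (\<lambda>p. f p *\<^sub>R X p + f' p *\<^sub>R Y p) Z p = f p *\<^sub>R \<N> W X Z p + f' p *\<^sub>R \<N> W Y Z p"
  unfolding op_nabla_contraction scaleR_right.sum sum.distrib[symmetric]
  using assms by (intro sum.cong refl)
    (simp add: contraction_linear_right sections_fibre scaleR_add_left)

lemma nabla_linear:
  assumes "X \<in> sections M A" "Y \<in> sections M A"
  shows "\<N> W Z (\<lambda>p. a *\<^sub>R X p + b *\<^sub>R Y p) p = a *\<^sub>R \<N> W Z X p + b *\<^sub>R \<N> W Z Y p"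
  unfolding op_nabla_contraction scaleR_right.sum sum.distrib[symmetric]
  using assms by (intro sum.cong refl) (simp add: D_lincomb scaleR_add_right mult.commute)

lemma nabla_Leibniz:
  assumes "f \<in> smooth_funs M" "Y \<in> sections M A"
  shows "\<N> X Z (\<lambda>p. f p *\<^sub>R Y p) p =
    f p *\<^sub>R \<N> X Z Y p + vf_app (op_anchor I Dh \<xi> h X Z) f p *\<^sub>R Y p"
  unfolding op_nabla_contraction op_anchor_contraction vf_app_def scaleR_right.sum scaleR_left.sum
    sum.distrib[symmetric]
  using assms by (intro sum.cong refl) (simp add: D_scale scaleR_add_right mult.commute)

lemma bracket_Leibniz:
  assumes f: "f \<in> smooth_funs M" and Y: "Y \<in> sections M A"
  shows "\<B> X1 X2 (\<lambda>p. f p *\<^sub>R Y p) p =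
    f p *\<^sub>R \<B> X1 X2 Y p + vf_app (op_anchor I Dh \<xi> h X1 X2) f p *\<^sub>R Y p"
  unfolding op_bracket_def nabla_Leibniz[OF f Y]
  using nabla_linear_left[OF Y Y, of f "\<lambda>_. 0" X1 X2 p]
    nabla_linear_right[OF Y Y, of X2 f "\<lambda>_. 0" X1 p]
  by (simp add: scaleR_add_right)

lemma skew_trilinear: "skew_trilinear M A \<B>"
  unfolding skew_trilinear_def
proof (intro conjI ballI allI ext)
  fix X X' Y Z p a b
  assume X: "X \<in> sections M A"
  show "\<B> X Y Z p = - \<B> Y X Z p"
    unfolding op_bracket_def
    using op_nabla_skew[of X Y Z p] op_nabla_skew[of Z X Y p] op_nabla_skew[of Y Z X p] by simp
  show "\<B> X Y Z p = - \<B> X Z Y p"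
    unfolding op_bracket_def
    using op_nabla_skew[of X Y Z p] op_nabla_skew[of Z X Y p] op_nabla_skew[of Y Z X p] by simp
  { assume X': "X' \<in> sections M A"
    show "\<B> (\<lambda>p. a *\<^sub>R X p + b *\<^sub>R X' p) Y Z p = a *\<^sub>R \<B> X Y Z p + b *\<^sub>R \<B> X' Y Z p"
      and "\<B> Y (\<lambda>p. a *\<^sub>R X p + b *\<^sub>R X' p) Z p = a *\<^sub>R \<B> Y X Z p + b *\<^sub>R \<B> Y X' Z p"
      and "\<B> Y Z (\<lambda>p. a *\<^sub>R X p + b *\<^sub>R X' p) p = a *\<^sub>R \<B> Y Z X p + b *\<^sub>R \<B> Y Z X' p"
      unfolding op_bracket_def
      by (simp_all add: nabla_linear_left[OF X X', of "\<lambda>_. a" "\<lambda>_. b"]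
          nabla_linear_right[OF X X', of _ "\<lambda>_. a" "\<lambda>_. b"]
          nabla_linear[OF X X'] scaleR_add_right) }
  assume "Y \<in> sections M A" "Z \<in> sections M A"
  with X show "\<B> X Y Z \<in> sections M A" by (rule op_bracket_sections)
qed

lemma three_lie_algebroid: "three_lie_algebroid M A (op_anchor I Dh \<xi> h) \<B>"
  unfolding three_lie_algebroid_def
  by (intro conjI ballI ext M A three_anchor skew_trilinear fundamental_identity bracket_Leibniz
      anchor_bracket)

end

theorem proposition3p4:
  fixes M :: "'m::{t2_space,second_countable_topology} manifold"
    and A :: "('m, 'v::real_vector) vbundle"
    and \<rho> :: "'m \<Rightarrow> 'v \<Rightarrow> ('m \<Rightarrow> real) \<Rightarrow> real"
    and I :: "'i set"
    and D :: "'i \<Rightarrow> ('m \<Rightarrow> 'v) \<Rightarrow> 'm \<Rightarrow> 'v"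
    and Dh :: "'i \<Rightarrow> 'm vfield"
    and Ds :: "'i \<Rightarrow> ('m \<Rightarrow> 'v \<Rightarrow> real) \<Rightarrow> 'm \<Rightarrow> 'v \<Rightarrow> real"
    and \<xi> :: "'i \<Rightarrow> 'm \<Rightarrow> 'v \<Rightarrow> real"
    and g h :: "'i \<Rightarrow> 'i \<Rightarrow> 'i \<Rightarrow> 'm \<Rightarrow> real"
  assumes "smooth_manifold M"
    and "anchored_bundle M A \<rho>"
    and "finite I"
    and "\<And>i. i \<in> I \<Longrightarrow> diff_operator M A (D i) (Dh i)"
    and "\<And>i. i \<in> I \<Longrightarrow> dual_operator M A (D i) (Dh i) (Ds i)"
    and "\<And>i. i \<in> I \<Longrightarrow> \<xi> i \<in> dual_sections M A"
    and "\<And>i k j. \<lbrakk>i \<in> I; k \<in> I; j \<in> I\<rbrakk> \<Longrightarrow> g i k j \<in> smooth_funs M"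
    and "\<And>i j. \<lbrakk>i \<in> I; j \<in> I\<rbrakk> \<Longrightarrow> Ds i (\<xi> j) = (\<lambda>p v. \<Sum>k\<in>I. g i k j p * \<xi> k p v)"
    and "\<And>i j k. \<lbrakk>i \<in> I; j \<in> I; k \<in> I\<rbrakk> \<Longrightarrow> h i j k \<in> smooth_funs M"
    and "\<And>i j k p. \<lbrakk>i \<in> I; j \<in> I; k \<in> I\<rbrakk> \<Longrightarrow> h i j k p = - h j i k p"
    and "\<And>i j k l r s p. \<lbrakk>i \<in> I; j \<in> I; k \<in> I; l \<in> I; r \<in> I; s \<in> I\<rbrakk> \<Longrightarrow>
           h k l r p * h i j s p + h i l r p * h j k s p + h j l r p * h k i s p = 0"
    and "\<And>i j k l r s p. \<lbrakk>i \<in> I; j \<in> I; k \<in> I; l \<in> I; r \<in> I; s \<in> I\<rbrakk> \<Longrightarrow>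
           h i j s p * h k l r p = h i j r p * h k l s p"
    and "\<And>i j r t p. \<lbrakk>i \<in> I; j \<in> I; r \<in> I; t \<in> I\<rbrakk> \<Longrightarrow>
           vf_app (Dh r) (h i j t) p = (\<Sum>s\<in>I. g r i s p * h j s t p + g r j s p * h s i t p)"
  shows "three_lie_algebroid M A (op_anchor I Dh \<xi> h) (op_bracket I D \<xi> h)"
proof -
  have A: "vector_bundle M A"
    using assms(2) unfolding anchored_bundle_def by blast
  have Dh_pairing: "Dh r p (pairing X (\<xi> i)) = \<xi> i p (D r X p) + (\<Sum>k\<in>I. g r k i p * \<xi> k p (X p))"
    if "r \<in> I" "i \<in> I" "X \<in> sections M A" for r i X p
  proof -
    have "pairing X (Ds r (\<xi> i)) = (\<lambda>p. vf_app (Dh r) (pairing X (\<xi> i)) p - pairing (D r X) (\<xi> i) p)"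
      using assms(5)[OF that(1)] assms(6)[OF that(2)] that(3) unfolding dual_operator_def by blast
    from fun_cong[OF this, of p] show ?thesis
      unfolding assms(8)[OF that(1,2)] pairing_def vf_app_def by simp
  qed
  interpret compatible_operators M A I D Dh \<xi> g h
    by (rule compatible_operators.intro)
      (fact assms(1) A assms(4) assms(6) Dh_pairing assms(9) assms(10) assms(11) assms(12)
        assms(13)[unfolded vf_app_def])+
  show ?thesis by (rule three_lie_algebroid)
qed

end
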